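(* Let $A$ generate a $C_0$-semigroup on the complex Hilbert space $H$, let $B\in\mathcal{L}(U,(\mathrm{dom}\,A^* )')$, and assume that for every $T>0$ the map $u\mapsto Lu$, $(Lu)(t)=\int_0^t e^{\mathcal{A}(t-s)}Bu(s)\,ds$, is linear and continuous from $L^2(0,T;U)$ into $L^2(0,T;H)$. Suppose that there exists a reducing subspace $E\neq\{0\}$ for $e^{At}$ such that the restriction of $e^{At}$ to $E$ extends to a $C_0$-group on $E$ for which $e^{-At}$ is exponentially stable on $E$ for $t\to+\infty$ (i.e. there are $M\ge 1$, $\gamma>0$ with $|e^{-At}y|\le Me^{-\gamma t}|y|$ for all $t\ge0$, $y\in E$). Then the system $\dot y=\mathcal{A}y+Bu$, $y(0)=y_0\in H$, is not NCVE.
   Context: Setting. $H$ is a complex Hilbert space with inner product $\langle\cdot,\cdot\rangle$ and norm $|\cdot|$; $A$ generates a $C_0$-semigroup $e^{At}$ on $H$; $A^*$ is its Hilbert space adjoint. The space $\mathrm{dom}\,A^*$ with the graph norm is a Hilbert space, not identified with its dual; $H$ is identified with its dual, so $\mathrm{dom}\,A^*\subset H=H'\subset(\mathrm{dom}\,A^* )'$ with continuous dense injections. $\mathcal{A}$ denotes the extension of $A$ to $(\mathrm{dom}\,A^* )'$ (the dual of $A^*\in\mathcal{L}(\mathrm{dom}\,A^*,H)$); its domain is $H$ and it generates a $C_0$-semigroup $e^{\mathcal{A}t}$ on $(\mathrm{dom}\,A^* )'$ extending $e^{At}$. $U$ is a Hilbert space. The solution of the system with initial state $y_0\in H$ and control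 $u\in L^2_{\rm loc}(0,+\infty;U)$ is $y^{y_0,u}(t)=e^{At}y_0+\int_0^t e^{\mathcal{A}(t-s)}Bu(s)\,ds$, which belongs to $L^2_{\rm loc}(0,+\infty;H)$ under the assumption on $L$. Definitions. $y_0\in H$ can be steered to the rest in time (at most) $T$ if there is a control $u\in L^2_{\rm loc}(0,+\infty;U)$ with support in $[0,T]$ such that $y^{y_0,u}$ has support in $[0,T]$ too. An element $y_0$ that can be steered to the rest is NCVE if for every $\epsilon>0$ there are a time $T_\epsilon$ and a control $u_\epsilon$ with support in $[0,T_\epsilon]$ steering $y_0$ to the rest in time at most $T_\epsilon$ with $\int_0^{+\infty}|u_\epsilon(s)|^2ds\le\epsilon^2$. The system is NCVE (null controllable with vanishing energy) if every element of $H$ is NCVE. A reducing subspace $E$ for $e^{At}$ is a closed subspace of $H$ such that both $E$ and one of its (closed) complementary subspaces are invariant under $e^{At}$ for all $t\ge0$. *)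

theory Defs
  imports "HOL-Analysis.Analysis" "HOL-Library.Function_Algebras"
begin

subsection \<open>Complex vector spaces and complex Hilbert spaces\<close>

class complex_vector = real_vector +
  fixes scaleC :: "complex \<Rightarrow> 'a \<Rightarrow> 'a"  (infixr "*\<^sub>C" 75)
  assumes scaleC_add_right: "a *\<^sub>C (x + y) = a *\<^sub>C x + a *\<^sub>C y"
    and scaleC_add_left: "(a + b) *\<^sub>C x = a *\<^sub>C x + b *\<^sub>C x"
    and scaleC_scaleC: "a *\<^sub>C (b *\<^sub>C x) = (a * b) *\<^sub>C x"
    and scaleC_of_real: "complex_of_real r *\<^sub>C x = r *\<^sub>R x"

text \<open>
  The complex inner product is linear in its first argument.  The real inner product of the
  type is its real part, so the norm of the type is the one induced by the complex inner product.
\<close>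
class complex_hilbert = complex_vector + real_inner + complete_space +
  fixes cinner :: "'a \<Rightarrow> 'a \<Rightarrow> complex"
  assumes cinner_commute: "cinner x y = cnj (cinner y x)"
    and cinner_add_left: "cinner (x + y) z = cinner x z + cinner y z"
    and cinner_scaleC_left: "cinner (a *\<^sub>C x) y = a * cinner x y"
    and inner_eq_Re_cinner: "inner x y = Re (cinner x y)"

instantiation complex :: complex_vector
begin
definition scaleC_complex :: "complex \<Rightarrow> complex \<Rightarrow> complex"
  where "scaleC_complex a x = a * x"
instance
  by standard (simp_all add: scaleC_complex_def algebra_simps scaleR_conv_of_real)
end

instantiation complex :: complex_hilbert
begin
definition cinner_complex :: "complex \<Rightarrow> complex \<Rightarrow> complex"
  where "cinner_complex x y = x * cnj y"
instance
  by standard (simp_all add: cinner_complex_def scaleC_complex_def algebra_simps inner_complex_def)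
end

text \<open>The pointwise operations, needed for complex-valued functionals.\<close>

instantiation "fun" :: (type, real_vector) real_vector
begin
definition scaleR_fun :: "real \<Rightarrow> ('a \<Rightarrow> 'b) \<Rightarrow> 'a \<Rightarrow> 'b"
  where "scaleR_fun r f = (\<lambda>x. r *\<^sub>R f x)"
instance
  by standard (simp_all add: scaleR_fun_def fun_eq_iff scaleR_add_right scaleR_add_left)
end

instantiation "fun" :: (type, complex_vector) complex_vector
begin
definition scaleC_fun :: "complex \<Rightarrow> ('a \<Rightarrow> 'b) \<Rightarrow> 'a \<Rightarrow> 'b"
  where "scaleC_fun a f = (\<lambda>x. a *\<^sub>C f x)"
instance
  by standard (simp_all add: scaleC_fun_def scaleR_fun_def fun_eq_iff
      scaleC_add_right scaleC_add_left scaleC_scaleC scaleC_of_real)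
end

definition csubspace :: "'a::complex_vector set \<Rightarrow> bool" where
  "csubspace X \<longleftrightarrow> 0 \<in> X \<and> (\<forall>x\<in>X. \<forall>y\<in>X. x + y \<in> X) \<and> (\<forall>a. \<forall>x\<in>X. a *\<^sub>C x \<in> X)"

subsection \<open>Semigroups and groups of operators\<close>

text \<open>
  Below, a normed space is given by a carrier \<^term>\<open>X\<close>, a subspace of a complex vector space,
  and a norm \<^term>\<open>N\<close> on it.  This covers \<open>H\<close> and its closed subspaces as well as the dual
  space \<open>(dom A\<^sup>*)'\<close>, whose elements are functionals.
\<close>

definition bounded_clinear_between ::
  "'a::complex_vector set \<Rightarrow> ('a \<Rightarrow> real) \<Rightarrow> 'b::complex_vector set \<Rightarrow> ('b \<Rightarrow> real) \<Rightarrow> ('a \<Rightarrow> 'b) \<Rightarrow> bool"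
  where
  "bounded_clinear_between X N Y M f \<longleftrightarrow>
     (\<forall>x\<in>X. f x \<in> Y) \<and>
     (\<forall>x\<in>X. \<forall>y\<in>X. f (x + y) = f x + f y) \<and>
     (\<forall>a. \<forall>x\<in>X. f (a *\<^sub>C x) = a *\<^sub>C f x) \<and>
     (\<exists>K. \<forall>x\<in>X. M (f x) \<le> K * N x)"

definition C0_semigroup ::
  "'a::complex_vector set \<Rightarrow> ('a \<Rightarrow> real) \<Rightarrow> (real \<Rightarrow> 'a \<Rightarrow> 'a) \<Rightarrow> bool" where
  "C0_semigroup X N T \<longleftrightarrow>
     (\<forall>t\<ge>0. bounded_clinear_between X N X N (T t)) \<and>
     (\<forall>x\<in>X. T 0 x = x) \<and>
     (\<forall>s\<ge>0. \<forall>t\<ge>0. \<forall>x\<in>X. T (s + t) x = T s (T t x)) \<and>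
     (\<forall>x\<in>X. ((\<lambda>t. N (T t x - x)) \<longlongrightarrow> 0) (at_right 0))"

definition C0_group ::
  "'a::complex_vector set \<Rightarrow> ('a \<Rightarrow> real) \<Rightarrow> (real \<Rightarrow> 'a \<Rightarrow> 'a) \<Rightarrow> bool" where
  "C0_group X N T \<longleftrightarrow>
     (\<forall>t. bounded_clinear_between X N X N (T t)) \<and>
     (\<forall>x\<in>X. T 0 x = x) \<and>
     (\<forall>s t. \<forall>x\<in>X. T (s + t) x = T s (T t x)) \<and>
     (\<forall>x\<in>X. ((\<lambda>t. N (T t x - x)) \<longlongrightarrow> 0) (at 0))"

text \<open>Unbounded operators are represented by their graphs.\<close>

definition generator ::
  "'a::complex_vector set \<Rightarrow> ('a \<Rightarrow> real) \<Rightarrow> (real \<Rightarrow> 'a \<Rightarrow> 'a) \<Rightarrow> ('a \<times> 'a) set" where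
  "generator X N T =
     {(x, y). x \<in> X \<and> y \<in> X \<and> ((\<lambda>h. N ((1 / h) *\<^sub>R (T h x - x) - y)) \<longlongrightarrow> 0) (at_right 0)}"

definition generates ::
  "'a::complex_vector set \<Rightarrow> ('a \<Rightarrow> real) \<Rightarrow> ('a \<times> 'a) set \<Rightarrow> (real \<Rightarrow> 'a \<Rightarrow> 'a) \<Rightarrow> bool" where
  "generates X N G T \<longleftrightarrow> C0_semigroup X N T \<and> generator X N T = G"

subsection \<open>The adjoint, the dual of its domain, and the extension of the generator\<close>

definition adjoint_graph :: "('h::complex_hilbert \<times> 'h) set \<Rightarrow> ('h \<times> 'h) set" where
  "adjoint_graph A = {(\<phi>, \<psi>). \<forall>(x, y)\<in>A. cinner y \<phi> = cinner x \<psi>}"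

definition dom_adj :: "('h::complex_hilbert \<times> 'h) set \<Rightarrow> 'h set" where
  "dom_adj A = Domain (adjoint_graph A)"

text \<open>Meaningful for densely defined \<^term>\<open>A\<close>, for which the adjoint is single-valued.\<close>
definition adj :: "('h::complex_hilbert \<times> 'h) set \<Rightarrow> 'h \<Rightarrow> 'h" where
  "adj A \<phi> = (THE \<psi>. (\<phi>, \<psi>) \<in> adjoint_graph A)"

definition graph_norm :: "('h::complex_hilbert \<times> 'h) set \<Rightarrow> 'h \<Rightarrow> real" where
  "graph_norm A \<phi> = sqrt ((norm \<phi>)\<^sup>2 + (norm (adj A \<phi>))\<^sup>2)"

text \<open>
  \<open>(dom A\<^sup>*)'\<close> consists of the continuous antilinear functionals on \<open>dom A\<^sup>*\<close> with the
  graph norm, so that the embedding \<open>x \<mapsto> \<langle>x, \<cdot>\<rangle>\<close> of \<open>H\<close> is complex linear.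
  Functionals are total functions on \<open>H\<close> with the value 0 outside \<open>dom A\<^sup>*\<close>, which
  makes equality of functionals equality of functions.
\<close>
definition dual_dom :: "('h::complex_hilbert \<times> 'h) set \<Rightarrow> ('h \<Rightarrow> complex) set" where
  "dual_dom A = {f.
     (\<forall>\<phi>. \<phi> \<notin> dom_adj A \<longrightarrow> f \<phi> = 0) \<and>
     (\<forall>\<phi>\<in>dom_adj A. \<forall>\<psi>\<in>dom_adj A. f (\<phi> + \<psi>) = f \<phi> + f \<psi>) \<and>
     (\<forall>a. \<forall>\<phi>\<in>dom_adj A. f (a *\<^sub>C \<phi>) = cnj a * f \<phi>) \<and>
     (\<exists>K. \<forall>\<phi>\<in>dom_adj A. cmod (f \<phi>) \<le> K * graph_norm A \<phi>)}"

definition dual_norm :: "('h::complex_hilbert \<times> 'h) set \<Rightarrow> ('h \<Rightarrow> complex) \<Rightarrow> real" where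
  "dual_norm A f = Sup {cmod (f \<phi>) |\<phi>. \<phi> \<in> dom_adj A \<and> graph_norm A \<phi> \<le> 1}"

definition embed :: "('h::complex_hilbert \<times> 'h) set \<Rightarrow> 'h \<Rightarrow> ('h \<Rightarrow> complex)" where
  "embed A x = (\<lambda>\<phi>. if \<phi> \<in> dom_adj A then cinner x \<phi> else 0)"

text \<open>
  The extension of \<^term>\<open>A\<close> to \<open>(dom A\<^sup>*)'\<close>: its domain is (the image of) \<open>H\<close>, and it is the
  dual operator of \<open>A\<^sup>* : dom A\<^sup>* \<rightarrow> H\<close>, that is \<open>x \<mapsto> \<langle>x, A\<^sup>* \<cdot>\<rangle>\<close>.
\<close>
definition extended_op ::
  "('h::complex_hilbert \<times> 'h) set \<Rightarrow> (('h \<Rightarrow> complex) \<times> ('h \<Rightarrow> complex)) set" where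
  "extended_op A =
     {(embed A x, (\<lambda>\<phi>. if \<phi> \<in> dom_adj A then cinner x (adj A \<phi>) else 0)) |x. True}"

subsection \<open>Bochner integral and square integrable functions\<close>

text \<open>
  The library's Bochner integral needs a second countable type of values, whereas the Hilbert
  spaces here need not be separable; and \<open>(dom A\<^sup>*)'\<close> is not a type.
\<close>

definition has_bochner_integral_in ::
  "'a::complex_vector set \<Rightarrow> ('a \<Rightarrow> real) \<Rightarrow> 'm measure \<Rightarrow> ('m \<Rightarrow> 'a) \<Rightarrow> 'a \<Rightarrow> bool" where
  "has_bochner_integral_in X N M f I \<longleftrightarrow>
     (\<forall>x\<in>space M. f x \<in> X) \<and> I \<in> X \<and>
     (\<exists>s. (\<forall>i::nat. Bochner_Integration.simple_bochner_integrable M (s i) \<and> s i ` space M \<subseteq> X) \<and>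
          (AE x in M. (\<lambda>i. N (f x - s i x)) \<longlonglongrightarrow> 0) \<and>
          (\<lambda>i. \<integral>\<^sup>+x. ennreal (N (f x - s i x)) \<partial>M) \<longlonglongrightarrow> 0 \<and>
          (\<lambda>i. N (Bochner_Integration.simple_bochner_integral M (s i) - I)) \<longlonglongrightarrow> 0)"

definition strongly_measurable :: "'m measure \<Rightarrow> ('m \<Rightarrow> 'a::real_normed_vector) \<Rightarrow> bool" where
  "strongly_measurable M f \<longleftrightarrow>
     (\<exists>s. (\<forall>i::nat. simple_function M (s i)) \<and> (AE x in M. (\<lambda>i. s i x) \<longlonglongrightarrow> f x))"

text \<open>The square of the \<open>L\<^sup>2\<close> norm over \<^term>\<open>S\<close>.\<close>
definition energy :: "real set \<Rightarrow> (real \<Rightarrow> 'a::real_normed_vector) \<Rightarrow> ennreal" where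
  "energy S u = (\<integral>\<^sup>+s. ennreal ((norm (u s))\<^sup>2) \<partial>lebesgue_on S)"

definition L2_on :: "real set \<Rightarrow> (real \<Rightarrow> 'a::real_normed_vector) set" where
  "L2_on S = {u. strongly_measurable (lebesgue_on S) u \<and> energy S u < \<infinity>}"

definition L2_loc :: "(real \<Rightarrow> 'a::real_normed_vector) set" where
  "L2_loc = {u. \<forall>\<tau>>0. u \<in> L2_on {0<..<\<tau>}}"

text \<open>Only the values on the half-line \<open>(0, +\<infinity>)\<close> matter; the support is taken up to null sets.\<close>
definition supported_upto :: "real \<Rightarrow> (real \<Rightarrow> 'a::real_normed_vector) \<Rightarrow> bool" where
  "supported_upto \<tau> u \<longleftrightarrow> 0 \<le> \<tau> \<and> (AE t in lebesgue_on {\<tau><..}. u t = 0)"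

subsection \<open>The control system\<close>

text \<open>
  In the following \<^term>\<open>T\<close> is the semigroup \<open>e\<^sup>A\<^sup>t\<close> on \<open>H\<close>, and \<^term>\<open>S\<close> is the semigroup
  generated by \<^term>\<open>extended_op A\<close> on \<open>(dom A\<^sup>*)'\<close>.
  \<open>input_integral A S B u t v\<close> says that the integral of \<open>S (t - s) (B (u s))\<close> over
  \<open>0 < s < t\<close> exists in \<open>(dom A\<^sup>*)'\<close> and equals \<^term>\<open>v\<close>.
\<close>
definition input_integral ::
  "('h::complex_hilbert \<times> 'h) set \<Rightarrow> (real \<Rightarrow> ('h \<Rightarrow> complex) \<Rightarrow> ('h \<Rightarrow> complex)) \<Rightarrow>
   ('u::complex_hilbert \<Rightarrow> ('h \<Rightarrow> complex)) \<Rightarrow> (real \<Rightarrow> 'u) \<Rightarrow> real \<Rightarrow> ('h \<Rightarrow> complex) \<Rightarrow> bool" where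
  "input_integral A S B u t v \<longleftrightarrow>
     has_bochner_integral_in (dual_dom A) (dual_norm A) (lebesgue_on {0<..<t})
       (\<lambda>s. S (t - s) (B (u s))) v"

text \<open>
  The map \<open>u \<mapsto> Lu\<close> is linear and continuous (i.e. bounded) from \<open>L\<^sup>2(0,\<tau>;U)\<close> to
  \<open>L\<^sup>2(0,\<tau>;H)\<close>.  Elements of these spaces are given by representatives, so that identities
  between them hold almost everywhere.
\<close>
definition input_map_continuous ::
  "('h::complex_hilbert \<times> 'h) set \<Rightarrow> (real \<Rightarrow> ('h \<Rightarrow> complex) \<Rightarrow> ('h \<Rightarrow> complex)) \<Rightarrow>
   ('u::complex_hilbert \<Rightarrow> ('h \<Rightarrow> complex)) \<Rightarrow> real \<Rightarrow> bool" where
  "input_map_continuous A S B \<tau> \<longleftrightarrow>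
     (\<exists>L :: (real \<Rightarrow> 'u) \<Rightarrow> (real \<Rightarrow> 'h).
        (\<forall>u\<in>L2_on {0<..<\<tau>}. L u \<in> L2_on {0<..<\<tau>} \<and>
           (AE t in lebesgue_on {0<..<\<tau>}. input_integral A S B u t (embed A (L u t)))) \<and>
        (\<forall>a b. \<forall>u\<in>L2_on {0<..<\<tau>}. \<forall>v\<in>L2_on {0<..<\<tau>}.
           AE t in lebesgue_on {0<..<\<tau>}.
             L (\<lambda>s. a *\<^sub>C u s + b *\<^sub>C v s) t = a *\<^sub>C L u t + b *\<^sub>C L v t) \<and>
        (\<exists>C\<ge>0. \<forall>u\<in>L2_on {0<..<\<tau>}.
           energy {0<..<\<tau>} (L u) \<le> ennreal (C\<^sup>2) * energy {0<..<\<tau>} u))"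

definition is_solution ::
  "('h::complex_hilbert \<times> 'h) set \<Rightarrow> (real \<Rightarrow> 'h \<Rightarrow> 'h) \<Rightarrow>
   (real \<Rightarrow> ('h \<Rightarrow> complex) \<Rightarrow> ('h \<Rightarrow> complex)) \<Rightarrow> ('u::complex_hilbert \<Rightarrow> ('h \<Rightarrow> complex)) \<Rightarrow>
   'h \<Rightarrow> (real \<Rightarrow> 'u) \<Rightarrow> (real \<Rightarrow> 'h) \<Rightarrow> bool" where
  "is_solution A T S B y0 u y \<longleftrightarrow>
     y \<in> L2_loc \<and>
     (AE t in lebesgue_on {0<..}.
        \<exists>v. input_integral A S B u t v \<and> embed A (y t) = embed A (T t y0) + v)"

text \<open>The solution is unique almost everywhere, which makes the quantifier over \<^term>\<open>y\<close> innocuous.\<close>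
definition steers_to_rest ::
  "('h::complex_hilbert \<times> 'h) set \<Rightarrow> (real \<Rightarrow> 'h \<Rightarrow> 'h) \<Rightarrow>
   (real \<Rightarrow> ('h \<Rightarrow> complex) \<Rightarrow> ('h \<Rightarrow> complex)) \<Rightarrow> ('u::complex_hilbert \<Rightarrow> ('h \<Rightarrow> complex)) \<Rightarrow>
   'h \<Rightarrow> (real \<Rightarrow> 'u) \<Rightarrow> real \<Rightarrow> bool" where
  "steers_to_rest A T S B y0 u \<tau> \<longleftrightarrow>
     u \<in> L2_loc \<and> supported_upto \<tau> u \<and>
     (\<exists>y. is_solution A T S B y0 u y \<and> supported_upto \<tau> y)"

definition NCVE_element ::
  "('h::complex_hilbert \<times> 'h) set \<Rightarrow> (real \<Rightarrow> 'h \<Rightarrow> 'h) \<Rightarrow>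
   (real \<Rightarrow> ('h \<Rightarrow> complex) \<Rightarrow> ('h \<Rightarrow> complex)) \<Rightarrow> ('u::complex_hilbert \<Rightarrow> ('h \<Rightarrow> complex)) \<Rightarrow>
   'h \<Rightarrow> bool" where
  "NCVE_element A T S B y0 \<longleftrightarrow>
     (\<exists>u \<tau>. steers_to_rest A T S B y0 u \<tau>) \<and>
     (\<forall>\<epsilon>>0. \<exists>\<tau> u. steers_to_rest A T S B y0 u \<tau> \<and> energy {0<..} u \<le> ennreal (\<epsilon>\<^sup>2))"

definition NCVE ::
  "('h::complex_hilbert \<times> 'h) set \<Rightarrow> (real \<Rightarrow> 'h \<Rightarrow> 'h) \<Rightarrow>
   (real \<Rightarrow> ('h \<Rightarrow> complex) \<Rightarrow> ('h \<Rightarrow> complex)) \<Rightarrow> ('u::complex_hilbert \<Rightarrow> ('h \<Rightarrow> complex)) \<Rightarrow>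
   bool" where
  "NCVE A T S B \<longleftrightarrow> (\<forall>y0. NCVE_element A T S B y0)"

definition reducing_subspace ::
  "(real \<Rightarrow> 'h::complex_hilbert \<Rightarrow> 'h) \<Rightarrow> 'h set \<Rightarrow> bool" where
  "reducing_subspace T E \<longleftrightarrow>
     csubspace E \<and> closed E \<and>
     (\<exists>F. csubspace F \<and> closed F \<and> E \<inter> F = {0} \<and> (\<forall>x. \<exists>e\<in>E. \<exists>f\<in>F. x = e + f) \<and>
          (\<forall>t\<ge>0. T t ` E \<subseteq> E \<and> T t ` F \<subseteq> F))"

end

theory Submission
  imports Defs
begin

text \<open>
  No nonzero \<open>y\<^sub>0 \<in> E\<close> is NCVE.  Let \<open>P\<close> be the bounded projection onto \<open>E\<close> along the invariant
  complement and \<open>\<phi> \<in> dom A\<^sup>*\<close>.  The vectors \<open>\<phi>\<^sub>s = (e\<^sup>-\<^sup>A\<^sup>s P)\<^sup>* \<phi>\<close> lie in \<open>dom A\<^sup>*\<close>, with graph norm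
  bounded by a multiple of \<open>e\<^sup>-\<^sup>\<gamma>\<^sup>s\<close>, because \<open>e\<^sup>-\<^sup>A\<^sup>s P\<close> commutes with the semigroup.  If \<open>u\<close> steers
  \<open>y\<^sub>0\<close> to rest and \<open>t\<close> is a later time at which the solution vanishes, then applying the solution
  formula at time \<open>t\<close> to \<open>\<phi>\<^sub>t\<close> gives \<open>0 = \<langle>y\<^sub>0, \<phi>\<rangle> + \<integral>\<^sub>0\<^sup>t \<langle>B u(s), \<phi>\<^sub>s\<rangle> ds\<close>.  Hence \<open>\<bar>\<langle>y\<^sub>0, \<phi>\<rangle>\<bar>\<close> is at
  most a multiple, depending on \<open>\<phi>\<close> but not on \<open>t\<close>, of the \<open>L\<^sup>2\<close> norm of \<open>u\<close>.  If that norm can be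
  arbitrarily small, \<open>y\<^sub>0\<close> is orthogonal to the dense space \<open>dom A\<^sup>*\<close>.
\<close>

section \<open>Hilbert and Banach space preliminaries\<close>

text \<open>The test vector may depend on the final time because that dependence cancels. Under
  \<open>S (t - s)\<close> it is pulled back by the adjoint of \<open>T (t - s)\<close>, and e^{-At}
  P e^{A(t-s)} = e^{-As} P, so what meets \<open>B (u s)\<close> is \<phi>_s. Its square-integrable
  decay over the half-line is the origin of the factor 1/(2\<gamma>). The pull-back rests on
  \<open>S t f \<phi> = f (cadjoint (T t) \<phi>)\<close>. As \<open>S\<close> is given only through
  its generator, this formula has to be derived: functionals are written as pairs of vectors of H by
  Riesz' theorem on the graph of the adjoint, and \<open>S\<close> is compared with \<open>T\<close>
  by uniqueness for the Cauchy problem. Two further obstacles shape the development. The dual of the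
  domain is a set with a norm, not a type, so semigroup theory is carried out on carriers that are
  images of Banach spaces. Values need not be separable and P is not given as bounded; measurable
  majorants handle the integrals, and closedness of both summands yields the boundedness.\<close>

instance complex_hilbert \<subseteq> banach ..

lemma cinner_add_right: "cinner x (y + z) = cinner x y + cinner x z"
  by (metis cinner_commute cinner_add_left complex_cnj_add)

lemma cinner_scaleC_right: "cinner x (a *\<^sub>C y) = cnj a * cinner x y"
  by (metis cinner_commute cinner_scaleC_left complex_cnj_mult)

lemma cinner_scaleR_left: "cinner (r *\<^sub>R x) y = of_real r * cinner x y"
  by (metis cinner_scaleC_left scaleC_of_real)

lemma cinner_diff_left: "cinner (x - y) z = cinner x z - cinner y z"
  by (metis add_diff_cancel cinner_add_left diff_add_cancel)

lemma cinner_diff_right: "cinner x (y - z) = cinner x y - cinner x z"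
  by (metis add_diff_cancel cinner_add_right diff_add_cancel)

lemma cinner_zero_left [simp]: "cinner 0 y = 0"
  using cinner_diff_left[of 0 0 y] by simp

lemma cinner_zero_right [simp]: "cinner x 0 = 0"
  using cinner_diff_right[of x 0 0] by simp

lemma cinner_self: "cinner x x = of_real ((norm x)\<^sup>2)"
proof -
  have "Im (cinner x x) = 0"
    using arg_cong[OF cinner_commute[of x x], of Im] by simp
  moreover have "Re (cinner x x) = (norm x)\<^sup>2"
    by (simp add: inner_eq_Re_cinner[symmetric] power2_norm_eq_inner)
  ultimately show ?thesis by (simp add: complex_eq_iff)
qed

lemma norm_scaleC: "norm (a *\<^sub>C (x::'a::complex_hilbert)) = cmod a * norm x"
proof -
  have "of_real ((norm (a *\<^sub>C x))\<^sup>2) = a * cnj a * cinner x x"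
    unfolding cinner_self[symmetric] by (simp add: cinner_scaleC_left cinner_scaleC_right)
  also have "\<dots> = of_real ((cmod a * norm x)\<^sup>2)"
    by (simp only: cinner_self complex_norm_square[symmetric]) (simp add: power_mult_distrib)
  finally have "(norm (a *\<^sub>C x))\<^sup>2 = (cmod a * norm x)\<^sup>2"
    using of_real_eq_iff by blast
  then show ?thesis by (simp add: power2_eq_iff_nonneg)
qed

text \<open>Multiplying \<open>x\<close> by the unimodular \<open>a\<close> turns the inner product
  into its modulus, a real number to which the real Cauchy-Schwarz inequality applies.\<close>

lemma cmod_cinner_le: "cmod (cinner x y) \<le> norm x * norm y"
proof (cases "cinner x y = 0")
  case False
  define a where "a = cnj (cinner x y) / of_real (cmod (cinner x y))"
  have "a * cinner x y = of_real (cmod (cinner x y))"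
    using False complex_norm_square[of "cinner x y"]
    by (simp add: a_def field_simps power2_eq_square)
  then have "cmod (cinner x y) = inner (a *\<^sub>C x) y"
    by (simp add: inner_eq_Re_cinner cinner_scaleC_left)
  also have "\<dots> \<le> norm (a *\<^sub>C x) * norm y"
    by (rule norm_cauchy_schwarz)
  also have "norm (a *\<^sub>C x) = norm x"
    using False by (simp add: norm_scaleC a_def norm_divide)
  finally show ?thesis .
qed simp

lemma bounded_linear_cinner_left: "bounded_linear (\<lambda>x. cinner x y)"
proof (rule bounded_linear_intro)
  show "norm (cinner x y) \<le> norm x * norm y" for x by (rule cmod_cinner_le)
qed (simp_all add: cinner_add_left cinner_scaleR_left scaleR_conv_of_real)

lemma eq_zero_if_cinner_zero: "(\<And>x. cinner x y = 0) \<Longrightarrow> y = 0"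
  by (metis cinner_self norm_eq_zero of_real_eq_0_iff zero_eq_power2)

text \<open>The representing vector minimises \<open>\<parallel>x\<parallel>\<^sup>2 - 2 f x\<close> over the subspace.\<close>
lemma riesz_on_closed_subspace:
  fixes V :: "'a::{real_inner, complete_space} set" and f :: "'a \<Rightarrow> real"
  assumes "closed V" "subspace V"
    and add: "\<And>x y. x \<in> V \<Longrightarrow> y \<in> V \<Longrightarrow> f (x + y) = f x + f y"
    and scale: "\<And>c x. x \<in> V \<Longrightarrow> f (c *\<^sub>R x) = c * f x"
    and bound: "\<And>x. x \<in> V \<Longrightarrow> \<bar>f x\<bar> \<le> K * norm x"
  shows "\<exists>a\<in>V. \<forall>x\<in>V. f x = inner a x"
proof -
  define J where "J x = (norm x)\<^sup>2 - 2 * f x" for x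
  define m where "m = Inf (J ` V)"
  have V0: "0 \<in> V" using assms(2) by (simp add: subspace_0)
  \<comment> \<open>Completing the square in \<open>norm x\<close> bounds \<open>J\<close>
    below.\<close>
  have "J x \<ge> - K\<^sup>2" if "x \<in> V" for x
  proof -
    have "f x \<le> K * norm x" using bound[OF that] by simp
    moreover have "0 \<le> (norm x - K)\<^sup>2" by simp
    ultimately show ?thesis by (simp add: J_def power2_eq_square algebra_simps)
  qed
  then have bdd: "bdd_below (J ` V)" by (auto simp: bdd_below_def)
  have m_le: "m \<le> J x" if "x \<in> V" for x
    unfolding m_def using bdd that by (simp add: cInf_lower)
  have "\<exists>x\<in>V. J x < m + inverse (real (Suc n))" for n
    using cInf_lessD[of "J ` V" "m + inverse (real (Suc n))"] V0 unfolding m_def by auto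
  then obtain s where s: "\<And>n. s n \<in> V" "\<And>n. J (s n) < m + inverse (real (Suc n))"
    by metis
  \<comment> \<open>Parallelogram law: the midpoint lies in \<open>V\<close>, so its value under
    \<open>J\<close> is at least \<open>m\<close>. Almost-minimisers are therefore close to each
    other.\<close>
  have par: "(norm (x - y))\<^sup>2 \<le> 2 * (J x - m) + 2 * (J y - m)" if "x \<in> V" "y \<in> V" for x y
  proof -
    have "(1/2) *\<^sub>R (x + y) \<in> V"
      using that assms(2) by (simp add: subspace_add subspace_scale)
    from m_le[OF this] have "m \<le> (norm (x + y))\<^sup>2 / 4 - (f x + f y)"
      using that assms(2)
      by (simp add: J_def scale add subspace_add power_divide add_divide_distrib)
    moreover have "(norm (x - y))\<^sup>2 + (norm (x + y))\<^sup>2 = 2 * (norm x)\<^sup>2 + 2 * (norm y)\<^sup>2"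
      by (simp add: power2_norm_eq_inner inner_diff inner_add algebra_simps inner_commute)
    ultimately show ?thesis by (simp add: J_def)
  qed
  have "Cauchy s"
  proof (rule metric_CauchyI)
    fix e :: real assume "e > 0"
    then obtain N where N: "inverse (real (Suc N)) < e\<^sup>2 / 4"
      using reals_Archimedean[of "e\<^sup>2 / 4"] by auto
    have "dist (s i) (s j) < e" if "i \<ge> N" "j \<ge> N" for i j
    proof -
      have small: "inverse (real (Suc k)) \<le> inverse (real (Suc N))" if "k \<ge> N" for k
        using that by (simp add: field_simps)
      have "(norm (s i - s j))\<^sup>2 < e\<^sup>2"
        using par[OF s(1) s(1), of i j] less_trans[OF less_le_trans[OF s(2)[of i]
            add_left_mono[OF small[OF that(1)]]] add_strict_left_mono[OF N]]
          less_trans[OF less_le_trans[OF s(2)[of j]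
            add_left_mono[OF small[OF that(2)]]] add_strict_left_mono[OF N]]
        by argo
      then show ?thesis using \<open>e > 0\<close> by (simp add: dist_norm power2_less_imp_less)
    qed
    then show "\<exists>N. \<forall>i\<ge>N. \<forall>j\<ge>N. dist (s i) (s j) < e" by blast
  qed
  then obtain a where a: "s \<longlonglongrightarrow> a"
    using Cauchy_convergent convergent_def by blast
  have aV: "a \<in> V" using closed_sequentially[OF assms(1) s(1) a] .
  have "f (s n) - f a = f (s n - a)" for n
    using add[of "s n - a" a] s(1) aV assms(2) by (simp add: subspace_diff)
  then have "norm (f (s n) - f a) \<le> norm (s n - a) * K" for n
    using bound[of "s n - a"] s(1) aV assms(2) by (simp add: subspace_diff mult.commute)
  moreover have "(\<lambda>n. norm (s n - a) * K) \<longlonglongrightarrow> 0"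
    using tendsto_mult_left_zero[OF LIM_zero[OF a, THEN tendsto_norm_zero]] by simp
  ultimately have "(\<lambda>n. f (s n) - f a) \<longlonglongrightarrow> 0"
    by (rule Lim_null_comparison[OF always_eventually, rule_format])
  then have "(\<lambda>n. f (s n)) \<longlonglongrightarrow> f a" by (simp add: LIM_zero_iff)
  then have "(\<lambda>n. J (s n)) \<longlonglongrightarrow> J a"
    unfolding J_def by (intro tendsto_intros a)
  moreover have "(\<lambda>n. m + inverse (real (Suc n))) \<longlonglongrightarrow> m + 0"
    by (intro tendsto_intros LIMSEQ_inverse_real_of_nat)
  ultimately have "J a \<le> m + 0"
    by (rule LIMSEQ_le) (use s(2) less_imp_le in blast)
  then have Ja: "J a \<le> m" by simp
  have "f x = inner a x" if x: "x \<in> V" for x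
  proof (rule ccontr)
    assume ne: "f x \<noteq> inner a x"
    define d where "d = inner a x - f x"
    define q where "q = (norm x)\<^sup>2"
    \<comment> \<open>For q > 0 the minimiser of c^2 q + 2 c d is - d / q; the denominator
      \<open>q + 1\<close> avoids division by zero and still yields a negative value.\<close>
    define c where "c = - d / (q + 1)"
    have q: "q \<ge> 0" by (simp add: q_def)
    have "m \<le> J (a + c *\<^sub>R x)"
      using aV x assms(2) by (intro m_le) (simp add: subspace_add subspace_scale)
    also have "J (a + c *\<^sub>R x) = J a + c\<^sup>2 * q + 2 * c * d"
      using aV x assms(2)
      by (simp add: J_def add scale subspace_scale q_def d_def power2_norm_eq_inner
          algebra_simps inner_commute)
        (simp add: power2_eq_square)
    finally have "0 \<le> c * (c * q + 2 * d)"
      using Ja by (simp add: algebra_simps power2_eq_square)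
    also have "c * (c * q + 2 * d) = - (d\<^sup>2 * (q + 2) / (q + 1)\<^sup>2)"
      using q by (simp add: c_def divide_simps power2_eq_square) (simp add: algebra_simps)
    also have "\<dots> < 0" using ne q by (simp add: d_def)
    finally show False by simp
  qed
  then show ?thesis using aV by blast
qed

text \<open>Riesz' theorem represents the real part of \<open>cinner (R x) \<phi>\<close>;
  evaluating at \<open>\<i> *\<^sub>C x\<close> recovers the imaginary part. Testing with the
  representing vector itself gives the norm bound with the same \<open>K\<close>.\<close>

lemma ex_cadjoint:
  fixes R :: "'h::complex_hilbert \<Rightarrow> 'h"
  assumes add: "\<And>x y. R (x + y) = R x + R y" and scale: "\<And>c x. R (c *\<^sub>C x) = c *\<^sub>C R x"
    and bound: "\<And>x. norm (R x) \<le> K * norm x"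
  shows "\<exists>R'. \<forall>\<phi>. norm (R' \<phi>) \<le> K * norm \<phi> \<and> (\<forall>x. cinner (R x) \<phi> = cinner x (R' \<phi>))"
proof -
  have "\<exists>\<psi>. norm \<psi> \<le> K * norm \<phi> \<and> (\<forall>x. cinner (R x) \<phi> = cinner x \<psi>)" for \<phi>
  proof -
    have bd: "\<bar>inner (R x) \<phi>\<bar> \<le> (K * norm \<phi>) * norm x" for x
      using Cauchy_Schwarz_ineq2[of "R x" \<phi>] mult_right_mono[OF bound[of x], of "norm \<phi>"]
      by (simp add: mult_ac)
    have scaleR: "R (c *\<^sub>R x) = c *\<^sub>R R x" for c x
      using scale[of "of_real c" x] by (simp add: scaleC_of_real)
    obtain \<psi> where \<psi>: "\<And>x. inner (R x) \<phi> = inner \<psi> x"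
      using riesz_on_closed_subspace[of UNIV "\<lambda>x. inner (R x) \<phi>", OF _ _ _ _ bd]
      by (auto simp: add scaleR inner_add_left)
    have re: "Re (cinner (R x) \<phi>) = Re (cinner x \<psi>)" for x
      using \<psi>[of x] by (metis inner_commute inner_eq_Re_cinner)
    have "Im (cinner (R x) \<phi>) = Im (cinner x \<psi>)" for x
      using re[of "\<i> *\<^sub>C x"] by (simp add: scale cinner_scaleC_left)
    then have eq: "cinner (R x) \<phi> = cinner x \<psi>" for x by (simp add: complex_eq_iff re)
    have "norm \<psi> * norm \<psi> \<le> (K * norm \<phi>) * norm \<psi>"
      using bd[of \<psi>] \<psi>[of \<psi>] by (simp add: power2_norm_eq_inner[symmetric] power2_eq_square)
    then have "norm \<psi> \<le> K * norm \<phi>"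
    proof (cases "\<psi> = 0")
      case True
      have "0 \<le> K * norm \<phi>"
        using order_trans[OF norm_ge_zero bound[of \<phi>]] .
      then show ?thesis using True by simp
    qed (simp add: mult_le_cancel_right)
    then show ?thesis using eq by blast
  qed
  then show ?thesis by metis
qed

text \<open>Zabreiko's lemma, a form of the open mapping theorem: it yields both the uniform
  boundedness principle and the boundedness of projections along closed subspaces.\<close>
lemma countably_subadditive_seminorm_bounded:
  fixes p :: "'a::banach \<Rightarrow> real"
  assumes tri: "\<And>x y. p (x + y) \<le> p x + p y" and sc: "\<And>c x. p (c *\<^sub>R x) = \<bar>c\<bar> * p x"
    and sub: "\<And>s x. summable (\<lambda>n. p (s n)) \<Longrightarrow> s sums x \<Longrightarrow> p x \<le> (\<Sum>n. p (s n))"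
  shows "\<exists>C\<ge>0. \<forall>x. p x \<le> C * norm x"
proof -
  define V where "V n = closure {x. p x \<le> real n}" for n
  have p0: "p 0 = 0" using sc[of 0 0] by simp
  have pm: "p (- x) = p x" for x using sc[of "-1" x] by simp
  have pnn: "p x \<ge> 0" for x using tri[of x "- x"] by (simp add: p0 pm)
  have "x \<in> (\<Union>n. V n)" for x
    using real_arch_simple[of "p x"] closure_subset by (force simp: V_def)
  then have UN: "(\<Union>n. V n) = UNIV" by blast
  \<comment> \<open>Baire: the closed sets \<open>V n\<close> cover the whole space, so they cannot
    all be nowhere dense.\<close>
  have "\<exists>n. interior (V n) \<noteq> {}"
  proof (rule ccontr)
    assume "\<not> ?thesis"
    then have "euclidean interior_of \<Union>(range V) = {}"
      by (intro Baire_category_alt) (auto simp: completely_metrizable_space_euclidean V_def)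
    then show False using UN by simp
  qed
  then obtain n z where "z \<in> interior (V n)" by auto
  then obtain r where r: "r > 0" "ball z r \<subseteq> V n"
    by (meson mem_interior)
  \<comment> \<open>Sublevel sets of a seminorm are convex and symmetric: averaging an approximation
    of \<open>z + y\<close> with the negative of one of \<open>z - y\<close> moves the ball from
    \<open>z\<close> to the origin.\<close>
  have near: "\<exists>v. p v \<le> real n \<and> norm (y - v) < d" if y: "norm y < r" and d: "d > 0" for y d
  proof -
    have "z + y \<in> V n" "z - y \<in> V n"
      using r y by (auto simp: dist_norm intro!: subsetD[OF r(2)])
    then obtain a b where a: "p a \<le> real n" "dist a (z + y) < d" and b: "p b \<le> real n" "dist b (z - y) < d"
      using d unfolding V_def closure_approachable by blast
    define v where "v = (1/2) *\<^sub>R (a + (- b))"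
    have "p v \<le> real n" unfolding v_def sc using tri[of a "- b"] a b by (simp add: pm)
    moreover have "norm (y - v) < d"
    proof -
      have "y - v = (1/2) *\<^sub>R (((z + y) - a) - ((z - y) - b))"
        by (simp add: v_def algebra_simps scaleR_2[symmetric])
      then have "norm (y - v) \<le> (1/2) * (norm ((z + y) - a) + norm ((z - y) - b))"
        by (metis (no_types, lifting) norm_scaleR norm_triangle_ineq4 abs_of_nonneg divide_nonneg_nonneg mult_left_mono zero_le_one zero_le_numeral)
      then show ?thesis using a(2) b(2) by (simp add: dist_norm norm_minus_commute)
    qed
    ultimately show ?thesis by blast
  qed
  \<comment> \<open>Scaling \<open>y\<close> to norm \<open>r / 2\<close>, inside the ball of radius
    \<open>r\<close>, turns the level \<open>n\<close> into \<open>2 * n / r\<close> per unit of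
    norm.\<close>
  define K where "K = 2 * real n / r"
  have K: "K \<ge> 0" using r by (simp add: K_def)
  have step: "\<exists>v. p v \<le> K * norm y \<and> norm (y - v) < d" if d: "d > 0" for y d
  proof (cases "y = 0")
    case True
    then show ?thesis using d by (intro exI[of _ 0]) (simp add: p0)
  next
    case False
    define c where "c = r / (2 * norm y)"
    have c: "c > 0" using False r by (simp add: c_def)
    have "norm (c *\<^sub>R y) < r" using False r by (simp add: c_def)
    then obtain v where v: "p v \<le> real n" "norm (c *\<^sub>R y - v) < c * d"
      using near[of "c *\<^sub>R y" "c * d"] mult_pos_pos[OF c d] by blast
    have "p ((1/c) *\<^sub>R v) \<le> K * norm y"
      using v(1) c False r unfolding sc by (simp add: K_def c_def field_simps)
    moreover have "norm (y - (1/c) *\<^sub>R v) < d"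
    proof -
      have "y - (1/c) *\<^sub>R v = (1/c) *\<^sub>R (c *\<^sub>R y - v)" using c by (simp add: scaleR_right_diff_distrib)
      then show ?thesis using v(2) c by (simp add: divide_less_eq mult.commute)
    qed
    ultimately show ?thesis by blast
  qed
  obtain ch where ch: "\<And>y d. d > 0 \<Longrightarrow> p (ch y d) \<le> K * norm y \<and> norm (y - ch y d) < d"
  proof (rule that[of "\<lambda>y d. SOME v. p v \<le> K * norm y \<and> norm (y - v) < d"])
    show "d > 0 \<Longrightarrow> p (SOME v. p v \<le> K * norm y \<and> norm (y - v) < d) \<le> K * norm y \<and>
        norm (y - (SOME v. p v \<le> K * norm y \<and> norm (y - v) < d)) < d" for y d
      using someI_ex[OF step] .
  qed
  have "p y \<le> (2 * K) * norm y" for y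
  proof (cases "y = 0")
    case True then show ?thesis by (simp add: p0)
  next
    case False
    \<comment> \<open>\<open>R k\<close> is what remains of \<open>y\<close> after \<open>k\<close>
      corrections. The allowance for its norm halves at every step, so the corrections
      \<open>s k\<close> sum to \<open>y\<close>, and their values under \<open>p\<close> are
      dominated by a geometric series of ratio 1/2; hence the factor 2.\<close>
    define R where "R = rec_nat y (\<lambda>k w. w - ch w (norm y * (1/2) ^ Suc k))"
    define s where "s k = ch (R k) (norm y * (1/2) ^ Suc k)" for k
    have R0: "R 0 = y" and RS: "R (Suc k) = R k - s k" for k
      by (simp_all add: R_def s_def)
    have Rn: "norm (R k) \<le> norm y * (1/2) ^ k" for k
    proof (cases k)
      case (Suc j)
      then show ?thesis
        using ch[of "norm y * (1/2) ^ Suc j" "R j"] False by (simp add: RS s_def)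
    qed (simp add: R0)
    have ps: "p (s k) \<le> K * norm y * (1/2) ^ k" for k
      using ch[of "norm y * (1/2) ^ Suc k" "R k"] False mult_left_mono[OF Rn[of k] K]
      by (simp add: s_def mult_ac)
    have part: "(\<Sum>k<n. s k) = y - R n" for n
      by (induction n) (simp_all add: R0 RS)
    have "(\<lambda>k. norm y * (1/2) ^ k) \<longlonglongrightarrow> norm y * 0"
      by (intro tendsto_intros LIMSEQ_realpow_zero) auto
    then have "(\<lambda>k. norm y * (1/2) ^ k) \<longlonglongrightarrow> 0" by simp
    then have "R \<longlonglongrightarrow> 0"
      by (rule Lim_null_comparison[OF always_eventually[OF allI[OF Rn]]])
    then have "(\<lambda>n. y - R n) \<longlonglongrightarrow> y - 0" by (intro tendsto_intros)
    then have "s sums y" by (simp add: sums_def part)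
    have geo: "(\<lambda>k. K * norm y * (1/2) ^ k) sums (K * norm y * 2)"
      using sums_mult[OF geometric_sums[of "1/2 :: real"], of "K * norm y"] by simp
    have sm: "summable (\<lambda>k. p (s k))"
      using ps pnn by (intro summable_comparison_test'[OF sums_summable[OF geo]]) auto
    have "p y \<le> (\<Sum>k. p (s k))" using sub[OF sm \<open>s sums y\<close>] .
    also have "\<dots> \<le> K * norm y * 2"
      using suminf_le[OF ps sm sums_summable[OF geo]] sums_unique[OF geo] by simp
    finally show ?thesis by simp
  qed
  then show ?thesis using K by (intro exI[of _ "2 * K"]) auto
qed

text \<open>The supremum of the family is again a seminorm, finite by the pointwise bounds.
  Continuity of each \<open>p n\<close> makes it countably subadditive, so Zabreiko's lemma applies
  to it.\<close>

lemma uniform_boundedness_seminorms: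
  fixes p :: "nat \<Rightarrow> 'a::banach \<Rightarrow> real"
  assumes tri: "\<And>n x y. p n (x + y) \<le> p n x + p n y"
    and sc: "\<And>n c x. p n (c *\<^sub>R x) = \<bar>c\<bar> * p n x"
    and bd: "\<And>n. \<exists>K. \<forall>x. p n x \<le> K * norm x"
    and pw: "\<And>x. \<exists>K. \<forall>n. p n x \<le> K"
  shows "\<exists>C\<ge>0. \<forall>n x. p n x \<le> C * norm x"
proof -
  define q where "q x = (SUP n. p n x)" for x
  have bdd: "bdd_above (range (\<lambda>n. p n x))" for x
    using pw[of x] by (auto simp: bdd_above_def)
  have pq: "p n x \<le> q x" for n x
    unfolding q_def by (rule cSUP_upper[OF _ bdd]) simp
  have qI: "(\<And>n. p n x \<le> c) \<Longrightarrow> q x \<le> c" for x c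
    unfolding q_def by (rule cSUP_least) auto
  have p0: "p n 0 = 0" for n using sc[of n 0 0] by simp
  have q0: "q 0 = 0" by (simp add: q_def p0)
  have q_sc_le: "q (c *\<^sub>R x) \<le> \<bar>c\<bar> * q x" for c x
    by (rule qI) (simp add: sc mult_left_mono pq)
  have q_sc: "q (c *\<^sub>R x) = \<bar>c\<bar> * q x" for c x
  proof (cases "c = 0")
    case False
    have "\<bar>c\<bar> * q x \<le> q (c *\<^sub>R x)"
      using q_sc_le[of "1/c" "c *\<^sub>R x"] False by (simp add: field_simps)
    then show ?thesis using q_sc_le[of c x] by simp
  qed (simp add: q0)
  have q_tri: "q (x + y) \<le> q x + q y" for x y
    by (rule qI) (rule order_trans[OF tri add_mono[OF pq pq]])
  have "\<exists>C\<ge>0. \<forall>x. q x \<le> C * norm x"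
  proof (rule countably_subadditive_seminorm_bounded[OF q_tri q_sc])
    fix s :: "nat \<Rightarrow> 'a" and x
    assume sm: "summable (\<lambda>n. q (s n))" and "s sums x"
    have qnn: "q y \<ge> 0" for y
      using q_tri[of y "- y"] q_sc[of "-1" y] by (simp add: q0)
    show "q x \<le> (\<Sum>n. q (s n))"
    proof (rule qI)
      fix n
      obtain K where K: "\<And>x. p n x \<le> K * norm x" using bd by blast
      have part: "p n (\<Sum>k<m. s k) \<le> (\<Sum>k. q (s k))" for m
      proof -
        have "p n (\<Sum>k<m. s k) \<le> (\<Sum>k<m. q (s k))"
        proof (induction m)
          case (Suc m)
          then show ?case using tri[of n "\<Sum>k<m. s k" "s m"] pq[of n "s m"] by simp
        qed (simp add: p0)
        also have "\<dots> \<le> (\<Sum>k. q (s k))" by (rule sum_le_suminf[OF sm]) (auto simp: qnn)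
        finally show ?thesis .
      qed
      have "p n x \<le> (\<Sum>k. q (s k)) + K * norm (x - (\<Sum>k<m. s k))" for m
        using tri[of n "\<Sum>k<m. s k" "x - (\<Sum>k<m. s k)"] part[of m] K[of "x - (\<Sum>k<m. s k)"] by simp
      moreover have "(\<lambda>m. (\<Sum>k. q (s k)) + K * norm (x - (\<Sum>k<m. s k))) \<longlonglongrightarrow> (\<Sum>k. q (s k)) + K * norm (x - x)"
        using \<open>s sums x\<close> unfolding sums_def by (intro tendsto_intros)
      ultimately show "p n x \<le> (\<Sum>k. q (s k))"
        by (intro LIMSEQ_le_const) auto
    qed
  qed
  then show ?thesis using pq order_trans by meson
qed

section \<open>Strongly continuous semigroups\<close>

text \<open>A seminormed carrier that is a controlled linear image of a Banach space: the uniform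
  boundedness principle is available on it.\<close>
locale banach_image =
  fixes X :: "'a::complex_vector set" and N :: "'a \<Rightarrow> real" and j :: "'b::banach \<Rightarrow> 'a" and C :: real
  assumes X: "csubspace X"
    and N_triangle: "\<And>x y. x \<in> X \<Longrightarrow> y \<in> X \<Longrightarrow> N (x + y) \<le> N x + N y"
    and N_scale: "\<And>c x. x \<in> X \<Longrightarrow> N (c *\<^sub>R x) = \<bar>c\<bar> * N x"
    and C: "C \<ge> 0"
    and j_in: "\<And>b. j b \<in> X"
    and j_add: "\<And>a b. j (a + b) = j a + j b"
    and j_scale: "\<And>c b. j (c *\<^sub>R b) = c *\<^sub>R j b"
    and j_bound: "\<And>b. N (j b) \<le> C * norm b"
    and j_onto: "\<And>x. x \<in> X \<Longrightarrow> \<exists>b. j b = x \<and> norm b \<le> C * N x"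
begin

lemma X_scaleR: "x \<in> X \<Longrightarrow> c *\<^sub>R x \<in> X"
  using X unfolding csubspace_def by (metis scaleC_of_real)

lemma X_add: "x \<in> X \<Longrightarrow> y \<in> X \<Longrightarrow> x + y \<in> X"
  using X unfolding csubspace_def by blast

lemma X_diff: "x \<in> X \<Longrightarrow> y \<in> X \<Longrightarrow> x - y \<in> X"
  using X_add[of x "- y"] X_scaleR[of y "-1"] by simp

lemma N_minus: "x \<in> X \<Longrightarrow> N (- x) = N x"
  using N_scale[of x "-1"] by simp

lemma N_zero [simp]: "N 0 = 0"
  using N_scale[of 0 0] X by (simp add: csubspace_def)

lemma N_nonneg: "x \<in> X \<Longrightarrow> N x \<ge> 0"
  using N_triangle[of x "- x"] X_scaleR[of x "-1"] N_minus[of x] by simp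

lemma N_minus_commute: "x \<in> X \<Longrightarrow> y \<in> X \<Longrightarrow> N (x - y) = N (y - x)"
  using N_minus[OF X_diff] by (metis minus_diff_eq)

lemma N_diff_le: "x \<in> X \<Longrightarrow> y \<in> X \<Longrightarrow> N (x - y) \<le> N x + N y"
  using N_triangle[of x "- y"] X_scaleR[of y "-1"] by (simp add: N_minus)

lemma N_triangle_diff: "x \<in> X \<Longrightarrow> y \<in> X \<Longrightarrow> z \<in> X \<Longrightarrow> N (x - z) \<le> N (x - y) + N (y - z)"
  using N_triangle[of "x - y" "y - z"] by (simp add: X_diff)

end

text \<open>Used twice: on H with \<open>j = id\<close> and \<open>C = 1\<close>, and on the dual of
  the domain of the adjoint with \<open>j = ext_pair\<close> and \<open>C = 2\<close>.\<close>

locale C0_semigroup_on = banach_image X N j C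
  for X :: "'a::complex_vector set" and N :: "'a \<Rightarrow> real" and j :: "'b::banach \<Rightarrow> 'a" and C :: real +
  fixes T :: "real \<Rightarrow> 'a \<Rightarrow> 'a"
  assumes semigroup: "C0_semigroup X N T"
begin

lemma T_in: "t \<ge> 0 \<Longrightarrow> x \<in> X \<Longrightarrow> T t x \<in> X"
  and T_add: "t \<ge> 0 \<Longrightarrow> x \<in> X \<Longrightarrow> y \<in> X \<Longrightarrow> T t (x + y) = T t x + T t y"
  and T_scaleC: "t \<ge> 0 \<Longrightarrow> x \<in> X \<Longrightarrow> T t (a *\<^sub>C x) = a *\<^sub>C T t x"
  and T_bound: "t \<ge> 0 \<Longrightarrow> \<exists>K. \<forall>x\<in>X. N (T t x) \<le> K * N x"
  and T_0: "x \<in> X \<Longrightarrow> T 0 x = x"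
  and T_plus: "s \<ge> 0 \<Longrightarrow> t \<ge> 0 \<Longrightarrow> x \<in> X \<Longrightarrow> T (s + t) x = T s (T t x)"
  and T_right: "x \<in> X \<Longrightarrow> ((\<lambda>t. N (T t x - x)) \<longlongrightarrow> 0) (at_right 0)"
  using semigroup unfolding C0_semigroup_def bounded_clinear_between_def by auto

lemma T_scaleR: "t \<ge> 0 \<Longrightarrow> x \<in> X \<Longrightarrow> T t (c *\<^sub>R x) = c *\<^sub>R T t x"
  by (metis T_scaleC scaleC_of_real)

lemma T_diff: "t \<ge> 0 \<Longrightarrow> x \<in> X \<Longrightarrow> y \<in> X \<Longrightarrow> T t (x - y) = T t x - T t y"
  using T_add[of t x "(-1) *\<^sub>R y"] T_scaleR[of t y "-1"] X_scaleR[of y "-1"] by simp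

text \<open>Otherwise the operators are unbounded along times tending to 0, although every orbit
  converges there. This contradicts uniform boundedness, which is used on the Banach space and
  carried to \<open>X\<close> by \<open>j\<close>.\<close>

lemma T_bounded_near_0: "\<exists>d>0. \<exists>K\<ge>0. \<forall>t x. 0 \<le> t \<longrightarrow> t < d \<longrightarrow> x \<in> X \<longrightarrow> N (T t x) \<le> K * N x"
proof (rule ccontr)
  assume asm: "\<not> ?thesis"
  have "\<exists>t x. 0 \<le> t \<and> t < inverse (real (Suc n)) \<and> x \<in> X \<and> N (T t x) > real (Suc n) * N x" for n
  proof -
    have "inverse (real (Suc n)) > 0" "real (Suc n) \<ge> 0" by simp_all
    with asm show ?thesis unfolding not_le[symmetric] by blast
  qed
  then obtain t x where t: "\<And>n. 0 \<le> t n" "\<And>n. t n < inverse (real (Suc n))" and x: "\<And>n. x n \<in> X"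
    and big: "\<And>n. N (T (t n) (x n)) > real (Suc n) * N (x n)"
    by metis
  \<comment> \<open>Time 0 must be excluded because the limit in \<open>T_right\<close> is taken
    through positive times only.\<close>
  have tpos: "t n > 0" for n
  proof (rule ccontr)
    assume "\<not> t n > 0"
    then have "t n = 0" using t(1)[of n] by simp
    then have "N (x n) > real (Suc n) * N (x n)" using big[of n] T_0[OF x] by simp
    moreover have "1 * N (x n) \<le> real (Suc n) * N (x n)"
      by (rule mult_right_mono) (use N_nonneg[OF x] in auto)
    ultimately show False by simp
  qed
  have t0: "filterlim t (at_right 0) sequentially"
  proof -
    have "t \<longlonglongrightarrow> 0"
    proof (rule tendsto_sandwich[OF _ _ tendsto_const LIMSEQ_inverse_real_of_nat])
      show "\<forall>\<^sub>F n in sequentially. 0 \<le> t n" using t(1) by simp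
      show "\<forall>\<^sub>F n in sequentially. t n \<le> inverse (real (Suc n))"
        by (intro always_eventually allI less_imp_le t(2))
    qed
    then show ?thesis using tpos by (auto simp: filterlim_at less_imp_neq[THEN not_sym])
  qed
  define p where "p n b = N (T (t n) (j b))" for n b
  have "\<exists>K\<ge>0. \<forall>n b. p n b \<le> K * norm b"
  proof (rule uniform_boundedness_seminorms)
    show "p n (a + b) \<le> p n a + p n b" for n a b
      by (simp add: p_def j_add T_add t(1) j_in N_triangle T_in)
    show "p n (c *\<^sub>R b) = \<bar>c\<bar> * p n b" for n c b
      by (simp add: p_def j_scale T_scaleR t(1) j_in N_scale T_in)
    show "\<exists>K. \<forall>b. p n b \<le> K * norm b" for n
    proof -
      obtain K where K: "\<forall>x\<in>X. N (T (t n) x) \<le> K * N x" using T_bound[OF t(1)] by blast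
      have "p n b \<le> (\<bar>K\<bar> * C) * norm b" for b
      proof -
        have "p n b \<le> K * N (j b)" unfolding p_def using K j_in by blast
        also have "\<dots> \<le> \<bar>K\<bar> * N (j b)" by (rule mult_right_mono) (use N_nonneg[OF j_in] in auto)
        also have "\<dots> \<le> \<bar>K\<bar> * (C * norm b)" by (rule mult_left_mono[OF j_bound]) simp
        finally show ?thesis by simp
      qed
      then show ?thesis by blast
    qed
    show "\<exists>K. \<forall>n. p n b \<le> K" for b
    proof -
      have "(\<lambda>n. N (T (t n) (j b) - j b)) \<longlonglongrightarrow> 0"
        using filterlim_compose[OF T_right[OF j_in] t0] .
      then have "Bseq (\<lambda>n. N (T (t n) (j b) - j b))"
        by (intro convergent_imp_Bseq) (auto simp: convergent_def)
      then obtain K where K: "\<And>n. norm (N (T (t n) (j b) - j b)) \<le> K" by (auto simp: Bseq_def)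
      have "p n b \<le> K + N (j b)" for n
        using N_triangle[of "T (t n) (j b) - j b" "j b"] K[of n]
        by (simp add: p_def X_diff T_in t(1) j_in)
      then show ?thesis by blast
    qed
  qed
  then obtain K where K: "K \<ge> 0" "\<And>n b. p n b \<le> K * norm b" by blast
  have *: "N (T (t n) y) \<le> (K * C) * N y" if y: "y \<in> X" for n y
  proof -
    obtain b where b: "j b = y" "norm b \<le> C * N y" using j_onto[OF y] by blast
    have "N (T (t n) y) \<le> K * norm b" using K(2)[of n b] b(1) by (simp add: p_def)
    also have "\<dots> \<le> K * (C * N y)" by (rule mult_left_mono[OF b(2) K(1)])
    finally show ?thesis by simp
  qed
  obtain n where n: "K * C \<le> real n" using real_arch_simple by blast
  have "N (T (t n) (x n)) \<le> (K * C) * N (x n)" by (rule *[OF x])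
  also have "\<dots> \<le> real (Suc n) * N (x n)"
    by (rule mult_right_mono) (use n N_nonneg[OF x] in auto)
  finally show False using big[of n] by simp
qed

text \<open>The semigroup law propagates the bound near 0 in steps of length \<open>d / 2\<close>,
  strictly shorter than \<open>d\<close> because that bound holds for times below
  \<open>d\<close>.\<close>

lemma T_locally_bounded:
  "\<exists>K\<ge>0. \<forall>t x. 0 \<le> t \<longrightarrow> t \<le> \<tau> \<longrightarrow> x \<in> X \<longrightarrow> N (T t x) \<le> K * N x"
proof -
  obtain d K0 where d: "d > 0" "K0 \<ge> 0"
    and K0: "\<And>t x. 0 \<le> t \<Longrightarrow> t < d \<Longrightarrow> x \<in> X \<Longrightarrow> N (T t x) \<le> K0 * N x"
    using T_bounded_near_0 by blast
  have step: "\<exists>K\<ge>0. \<forall>t x. 0 \<le> t \<longrightarrow> t \<le> real n * (d / 2) \<longrightarrow> x \<in> X \<longrightarrow> N (T t x) \<le> K * N x" for n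
  proof (induction n)
    case 0
    show ?case by (intro exI[of _ 1]) (auto simp: T_0)
  next
    case (Suc n)
    then obtain K where K: "K \<ge> 0"
      "\<And>t x. 0 \<le> t \<Longrightarrow> t \<le> real n * (d / 2) \<Longrightarrow> x \<in> X \<Longrightarrow> N (T t x) \<le> K * N x"
      by blast
    have "N (T t x) \<le> (K0 * K + K) * N x" if t: "0 \<le> t" "t \<le> real (Suc n) * (d / 2)" "x \<in> X" for t x
    proof (cases "t \<le> real n * (d / 2)")
      case True
      have "N (T t x) \<le> K * N x" by (rule K(2)[OF t(1) True t(3)])
      also have "\<dots> \<le> (K0 * K + K) * N x"
        by (rule mult_right_mono) (use d K(1) N_nonneg[OF t(3)] in auto)
      finally show ?thesis .
    next
      case False
      define s where "s = real n * (d / 2)"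
      have s: "0 \<le> s" "0 \<le> t - s" "t - s < d"
        using False d(1) t(2) by (simp_all add: s_def algebra_simps)
      have "T t x = T (t - s) (T s x)" using T_plus[OF s(2,1) t(3)] by simp
      then have "N (T t x) \<le> K0 * N (T s x)" using K0[OF s(2,3) T_in[OF s(1) t(3)]] by simp
      also have "\<dots> \<le> K0 * (K * N x)"
        by (rule mult_left_mono[OF K(2) d(2)]) (use s t(3) in \<open>auto simp: s_def\<close>)
      also have "\<dots> \<le> (K0 * K + K) * N x"
        using K(1) N_nonneg[OF t(3)] by (simp add: algebra_simps)
      finally show ?thesis .
    qed
    moreover have "K0 * K + K \<ge> 0" using d K(1) by simp
    ultimately show ?case by blast
  qed
  obtain n where "\<tau> \<le> real n * (d / 2)"
    using real_arch_simple[of "\<tau> / (d / 2)"] d(1) by (auto simp: field_simps)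
  then show ?thesis using step[of n] order_trans by meson
qed

section \<open>Strong continuity of orbits and invariance of the generator\<close>

lemma T_near_0:
  assumes "x \<in> X" "e > 0"
  shows "\<exists>d>0. \<forall>h. 0 \<le> h \<longrightarrow> h < d \<longrightarrow> N (T h x - x) < e"
proof -
  have "\<forall>\<^sub>F h in at_right 0. N (T h x - x) < e"
    using order_tendstoD(2)[OF T_right[OF assms(1)] assms(2)] .
  then obtain d where d: "d > 0" "\<And>h. 0 < h \<Longrightarrow> h < d \<Longrightarrow> N (T h x - x) < e"
    by (auto simp: eventually_at_right_field)
  have "N (T h x - x) < e" if "0 \<le> h" "h < d" for h
    using that d(2)[of h] assms by (cases "h = 0") (auto simp: T_0)
  then show ?thesis using d(1) by blast
qed

text \<open>Factoring out the operator at the earlier of the two times, T(r+h)x - T(r)x = T(r)(T(h)x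
  - x), reduces both one-sided limits to continuity at 0 and a local bound on T(r).\<close>

lemma T_continuous:
  assumes x: "x \<in> X" and t: "t \<ge> 0" and e: "e > 0"
  shows "\<exists>d>0. \<forall>s\<ge>0. \<bar>s - t\<bar> < d \<longrightarrow> N (T s x - T t x) < e"
proof -
  obtain K where K: "K \<ge> 0" "\<And>s y. 0 \<le> s \<Longrightarrow> s \<le> t + 1 \<Longrightarrow> y \<in> X \<Longrightarrow> N (T s y) \<le> K * N y"
    using T_locally_bounded[of "t + 1"] by blast
  obtain d where d: "d > 0" "\<And>h. 0 \<le> h \<Longrightarrow> h < d \<Longrightarrow> N (T h x - x) < e / (K + 1)"
    using T_near_0[OF x, of "e / (K + 1)"] e K(1) by auto
  have est: "N (T (r + h) x - T r x) < e" if "0 \<le> r" "r \<le> t + 1" "0 \<le> h" "h < d" for r h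
  proof -
    have "T (r + h) x - T r x = T r (T h x - x)"
      using that x by (simp add: T_plus T_diff T_in)
    then have "N (T (r + h) x - T r x) \<le> K * N (T h x - x)"
      using K(2)[of r "T h x - x"] that x by (simp add: X_diff T_in)
    also have "\<dots> \<le> K * (e / (K + 1))"
      by (rule mult_left_mono[OF less_imp_le[OF d(2)] K(1)]) (use that in auto)
    also have "\<dots> < e" using e K(1) by (simp add: field_simps)
    finally show ?thesis .
  qed
  have "N (T s x - T t x) < e" if "s \<ge> 0" "\<bar>s - t\<bar> < d" for s
  proof (cases "s \<ge> t")
    case True
    then show ?thesis using est[of t "s - t"] t that by simp
  next
    case False
    then show ?thesis using est[of s "t - s"] t that x
      by (simp add: N_minus_commute[of "T s x"] T_in)
  qed
  then show ?thesis using d(1) by blast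
qed

lemma T_tendsto:
  assumes "x \<in> X" "t \<ge> 0"
  shows "((\<lambda>s. N (T s x - T t x)) \<longlongrightarrow> 0) (at t within {0..})"
  unfolding tendsto_iff
proof (intro allI impI)
  fix e :: real assume "e > 0"
  from T_continuous[OF assms this] obtain d where
    "d > 0" "\<And>s. s \<ge> 0 \<Longrightarrow> \<bar>s - t\<bar> < d \<Longrightarrow> N (T s x - T t x) < e" by blast
  then show "\<forall>\<^sub>F s in at t within {0..}. dist (N (T s x - T t x)) 0 < e"
    unfolding eventually_at using assms
    by (intro exI[of _ d]) (auto simp: dist_real_def N_nonneg X_diff T_in)
qed

text \<open>A bounded operator carries the difference quotient of \<open>x\<close> to that of
  \<open>G x\<close> as soon as it commutes with the semigroup on this one orbit.\<close>

lemma generator_commute: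
  assumes lin: "\<And>y z. y \<in> X \<Longrightarrow> z \<in> X \<Longrightarrow> G (y - z) = G y - G z"
    and scale: "\<And>c y. y \<in> X \<Longrightarrow> G (c *\<^sub>R y) = c *\<^sub>R G y"
    and maps: "\<And>y. y \<in> X \<Longrightarrow> G y \<in> X"
    and bound: "\<And>y. y \<in> X \<Longrightarrow> N (G y) \<le> K * N y"
    and comm: "\<And>h. h \<ge> 0 \<Longrightarrow> G (T h x) = T h (G x)"
    and gen: "(x, z) \<in> generator X N T"
  shows "(G x, G z) \<in> generator X N T"
proof -
  have x: "x \<in> X" and z: "z \<in> X"
    and lim: "((\<lambda>h. N ((1 / h) *\<^sub>R (T h x - x) - z)) \<longlongrightarrow> 0) (at_right 0)"
    using gen by (auto simp: generator_def)
  have "((\<lambda>h. N ((1 / h) *\<^sub>R (T h (G x) - G x) - G z)) \<longlongrightarrow> 0) (at_right 0)"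
  proof (rule Lim_null_comparison)
    show "((\<lambda>h. N ((1 / h) *\<^sub>R (T h x - x) - z) * K) \<longlongrightarrow> 0) (at_right 0)"
      by (rule tendsto_mult_left_zero[OF lim])
    show "\<forall>\<^sub>F h in at_right 0. norm (N ((1 / h) *\<^sub>R (T h (G x) - G x) - G z))
        \<le> N ((1 / h) *\<^sub>R (T h x - x) - z) * K"
      unfolding eventually_at_filter
    proof (intro always_eventually allI impI)
      fix h :: real assume "h \<in> {0<..}"
      then have h: "h \<ge> 0" by simp
      have in_X: "T h x - x \<in> X" "(1 / h) *\<^sub>R (T h x - x) \<in> X" "(1 / h) *\<^sub>R (T h x - x) - z \<in> X"
        using x z h by (simp_all add: X_diff X_scaleR T_in)
      have eq: "(1 / h) *\<^sub>R (T h (G x) - G x) - G z = G ((1 / h) *\<^sub>R (T h x - x) - z)"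
        using x z h in_X by (simp add: comm[symmetric] lin scale T_in)
      show "norm (N ((1 / h) *\<^sub>R (T h (G x) - G x) - G z)) \<le> N ((1 / h) *\<^sub>R (T h x - x) - z) * K"
        unfolding eq using bound[OF in_X(3)] N_nonneg[OF maps[OF in_X(3)]] by (simp add: mult.commute)
    qed
  qed
  then show ?thesis using x z maps by (simp add: generator_def)
qed

lemma generator_invariant:
  assumes "(x, z) \<in> generator X N T" "t \<ge> 0"
  shows "(T t x, T t z) \<in> generator X N T"
proof -
  obtain K where K: "\<forall>x\<in>X. N (T t x) \<le> K * N x" using T_bound[OF assms(2)] by blast
  have x: "x \<in> X" using assms(1) by (simp add: generator_def)
  show ?thesis
  proof (rule generator_commute[OF _ _ _ _ _ assms(1)])
    show "T t (T h x) = T h (T t x)" if "h \<ge> 0" for h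
      using T_plus[OF that assms(2) x] T_plus[OF assms(2) that x] by (simp add: add.commute)
    show "N (T t y) \<le> K * N y" if "y \<in> X" for y using K that by blast
  qed (use assms(2) in \<open>simp_all add: T_diff T_scaleR T_in\<close>)
qed

text \<open>The locale makes \<open>N\<close> a seminorm, so limits are determined up to
  \<open>N\<close>-distance zero; on H this becomes equality.\<close>

lemma generator_unique:
  assumes "(x, z) \<in> generator X N T" "(x, z') \<in> generator X N T"
  shows "N (z - z') = 0"
proof -
  have x: "x \<in> X" "z \<in> X" "z' \<in> X" using assms by (auto simp: generator_def)
  have "((\<lambda>h. N ((1 / h) *\<^sub>R (T h x - x) - z) + N ((1 / h) *\<^sub>R (T h x - x) - z')) \<longlongrightarrow> 0 + 0) (at_right 0)"
    using assms by (intro tendsto_add) (auto simp: generator_def)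
  moreover have "\<forall>\<^sub>F h in at_right 0.
      N (z - z') \<le> N ((1 / h) *\<^sub>R (T h x - x) - z) + N ((1 / h) *\<^sub>R (T h x - x) - z')"
    unfolding eventually_at_filter
  proof (intro always_eventually allI impI)
    fix h :: real assume "h \<in> {0<..}"
    then have "(1 / h) *\<^sub>R (T h x - x) \<in> X" using x by (simp add: X_diff X_scaleR T_in)
    then show "N (z - z') \<le> N ((1 / h) *\<^sub>R (T h x - x) - z) + N ((1 / h) *\<^sub>R (T h x - x) - z')"
      using N_triangle_diff[of z "(1 / h) *\<^sub>R (T h x - x)" z'] x
        N_minus_commute[of z "(1 / h) *\<^sub>R (T h x - x)"] by simp
  qed
  ultimately have "N (z - z') \<le> 0 + 0"
    by (intro tendsto_lowerbound[of _ _ "at_right (0::real)"]) auto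
  then show ?thesis using N_nonneg[OF X_diff[OF x(2,3)]] by simp
qed

end

section \<open>One-sided calculus for vector-valued functions\<close>

lemma integral_right_difference_quotient:
  fixes f :: "real \<Rightarrow> 'a::banach"
  assumes "continuous_on {0..} f" "h \<ge> 0"
  shows "((\<lambda>r. (1 / r) *\<^sub>R (integral {0..h + r} f - integral {0..h} f)) \<longlongrightarrow> f h) (at_right 0)"
proof -
  let ?I = "\<lambda>u. integral {0..u} f"
  \<comment> \<open>Taking the derivative within \<open>{0..h + 1}\<close> covers the endpoint
    \<open>h = 0\<close>; afterwards \<open>h\<close> is approached from the right.\<close>
  have "(?I has_vector_derivative f h) (at h within {0..h + 1})"
    by (rule integral_has_vector_derivative)
      (use assms in \<open>auto intro: continuous_on_subset\<close>)
  then have lim: "((\<lambda>y. (1 / norm (y - h)) *\<^sub>R (?I y - (?I h + (y - h) *\<^sub>R f h))) \<longlongrightarrow> 0)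
      (at h within {0..h + 1})"
    by (simp add: has_vector_derivative_def has_derivative_within)
  have "filterlim (\<lambda>r. h + r) (at h within {0..h + 1}) (at_right 0)"
    unfolding filterlim_at
  proof
    show "\<forall>\<^sub>F r in at_right 0. h + r \<in> {0..h + 1} \<and> h + r \<noteq> h"
      using assms(2) by (auto simp: eventually_at_right_field intro!: exI[of _ 1])
    have "((\<lambda>r. h + r) \<longlongrightarrow> h + 0) (at_right 0)" by (intro tendsto_intros)
    then show "((\<lambda>r. h + r) \<longlongrightarrow> h) (at_right 0)" by simp
  qed
  from filterlim_compose[OF lim this]
  have "((\<lambda>r. (1 / \<bar>r\<bar>) *\<^sub>R (?I (h + r) - (?I h + r *\<^sub>R f h))) \<longlongrightarrow> 0) (at_right 0)" by simp
  then have "((\<lambda>r. (1 / r) *\<^sub>R (?I (h + r) - ?I h) - f h) \<longlongrightarrow> 0) (at_right 0)"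
  proof (rule Lim_transform_eventually)
    show "\<forall>\<^sub>F r in at_right 0. (1 / \<bar>r\<bar>) *\<^sub>R (?I (h + r) - (?I h + r *\<^sub>R f h))
        = (1 / r) *\<^sub>R (?I (h + r) - ?I h) - f h"
      unfolding eventually_at_filter
      by (intro always_eventually allI impI) (simp add: algebra_simps)
  qed
  then show ?thesis by (simp add: LIM_zero_iff)
qed

text \<open>A generator controls right difference quotients only. The set of \<open>s\<close> with
  \<open>norm (w s - w a) \<le> e * (s - a)\<close> is closed, and the right derivative pushes its
  supremum past every point before \<open>b\<close>.\<close>

lemma constant_if_zero_right_derivative:
  fixes w :: "real \<Rightarrow> 'a::real_normed_vector"
  assumes ab: "a \<le> b" and cont: "continuous_on {a..b} w"
    and der: "\<And>s. a \<le> s \<Longrightarrow> s < b \<Longrightarrow> ((\<lambda>h. norm (w (s + h) - w s) / h) \<longlongrightarrow> 0) (at_right 0)"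
  shows "w b = w a"
proof -
  have "norm (w b - w a) \<le> e * (b - a)" if e: "e > 0" for e
  proof -
    define Z where "Z = {s \<in> {a..b}. norm (w s - w a) \<le> e * (s - a)}"
    define c where "c = Sup Z"
    have aZ: "a \<in> Z" using ab by (simp add: Z_def)
    have "closed Z"
    proof -
      have "Z = {a..b} \<inter> (\<lambda>s. norm (w s - w a) - e * (s - a)) -` {..0}" by (auto simp: Z_def)
      moreover have "continuous_on {a..b} (\<lambda>s. norm (w s - w a) - e * (s - a))"
        by (intro continuous_intros cont)
      ultimately show ?thesis by (simp add: continuous_closed_preimage)
    qed
    have bdd: "bdd_above Z" by (rule bdd_aboveI[of _ b]) (auto simp: Z_def)
    have cZ: "c \<in> Z"
      unfolding c_def using aZ by (intro closed_contains_Sup[OF _ bdd \<open>closed Z\<close>]) auto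
    have "c = b"
    proof (rule ccontr)
      assume "c \<noteq> b"
      then have c: "a \<le> c" "c < b" using cZ by (auto simp: Z_def)
      have "\<forall>\<^sub>F h in at_right 0. norm (w (c + h) - w c) / h < e"
        using order_tendstoD(2)[OF der[OF c] e] .
      then obtain d where d: "d > 0" "\<And>h. 0 < h \<Longrightarrow> h < d \<Longrightarrow> norm (w (c + h) - w c) / h < e"
        by (auto simp: eventually_at_right_field)
      define h where "h = min (d / 2) (b - c)"
      have h: "0 < h" "h < d" "c + h \<le> b" using d(1) c by (auto simp: h_def)
      have "norm (w (c + h) - w c) < e * h" using d(2)[OF h(1,2)] h(1) by (simp add: divide_less_eq)
      moreover have "norm (w c - w a) \<le> e * (c - a)" using cZ by (simp add: Z_def)
      moreover have "norm (w (c + h) - w a) \<le> norm (w (c + h) - w c) + norm (w c - w a)"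
        using norm_triangle_ineq[of "w (c + h) - w c" "w c - w a"] by simp
      ultimately have "c + h \<in> Z" using c h by (simp add: Z_def algebra_simps)
      then have "c + h \<le> c" unfolding c_def by (rule cSup_upper[OF _ bdd])
      then show False using h(1) by simp
    qed
    then show ?thesis using cZ by (simp add: Z_def)
  qed
  then have "norm (w b - w a) \<le> 0 + e" if "e > 0" for e
  proof -
    have "norm (w b - w a) \<le> e / (b - a + 1) * (b - a)"
      using \<open>\<And>e. e > 0 \<Longrightarrow> norm (w b - w a) \<le> e * (b - a)\<close>[of "e / (b - a + 1)"] that ab by simp
    also have "\<dots> \<le> e" using that ab by (simp add: field_simps)
    finally show ?thesis by simp
  qed
  then have "norm (w b - w a) \<le> 0" by (rule field_le_epsilon)
  then show ?thesis by simp
qed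

section \<open>The generator on the Hilbert space and its adjoint\<close>

text \<open>The bound is an explicit parameter so that a decaying constant can be passed on to the
  adjoint. Its sign is left open.\<close>

definition bounded_op :: "real \<Rightarrow> ('h::complex_hilbert \<Rightarrow> 'h) \<Rightarrow> bool" where
  "bounded_op K L \<longleftrightarrow> (\<forall>x y. L (x + y) = L x + L y) \<and> (\<forall>c x. L (c *\<^sub>C x) = c *\<^sub>C L x) \<and>
     (\<forall>x. norm (L x) \<le> K * norm x)"

definition cadjoint :: "('h::complex_hilbert \<Rightarrow> 'h) \<Rightarrow> 'h \<Rightarrow> 'h" where
  "cadjoint L = (SOME L'. \<forall>\<phi> x. cinner (L x) \<phi> = cinner x (L' \<phi>))"

lemma bounded_op_scaleR: "bounded_op K L \<Longrightarrow> L (c *\<^sub>R x) = c *\<^sub>R L x"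
  unfolding bounded_op_def by (metis scaleC_of_real)

lemma bounded_op_diff: "bounded_op K L \<Longrightarrow> L (x - y) = L x - L y"
  unfolding bounded_op_def by (metis add_diff_cancel diff_add_cancel)

lemma bounded_op_bound: "bounded_op K L \<Longrightarrow> norm (L x) \<le> K * norm x"
  by (simp add: bounded_op_def)

lemma bounded_op_bounded_linear: "bounded_op K L \<Longrightarrow> bounded_linear L"
  using bounded_op_scaleR[of K L]
  by (intro bounded_linear_intro[where K = K]) (auto simp: bounded_op_def mult.commute)

lemma cinner_cadjoint: "bounded_op K L \<Longrightarrow> cinner (L x) \<phi> = cinner x (cadjoint L \<phi>)"
proof -
  assume "bounded_op K L"
  then have "\<exists>L'. \<forall>\<phi> x. cinner (L x) \<phi> = cinner x (L' \<phi>)"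
    using ex_cadjoint[of L K] by (auto simp: bounded_op_def)
  then show ?thesis unfolding cadjoint_def by (rule someI2_ex) blast
qed

text \<open>Adjoints are unique, so the chosen one coincides with the bounded one supplied by
  \<open>ex_cadjoint\<close>.\<close>

lemma norm_cadjoint_le: "bounded_op K L \<Longrightarrow> norm (cadjoint L \<phi>) \<le> K * norm \<phi>"
proof -
  assume L: "bounded_op K L"
  then obtain L' where L': "\<And>\<phi>. norm (L' \<phi>) \<le> K * norm \<phi>" "\<And>\<phi> x. cinner (L x) \<phi> = cinner x (L' \<phi>)"
    using ex_cadjoint[of L K] by (auto simp: bounded_op_def)
  have "cadjoint L \<phi> - L' \<phi> = 0"
    by (rule eq_zero_if_cinner_zero)
      (simp add: cinner_diff_right cinner_cadjoint[OF L, symmetric] L'(2)[symmetric])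
  then show ?thesis using L'(1)[of \<phi>] by simp
qed

locale hilbert_C0_semigroup =
  fixes A :: "('h::complex_hilbert \<times> 'h) set" and T :: "real \<Rightarrow> 'h \<Rightarrow> 'h"
  assumes gen: "generates UNIV norm A T"

sublocale hilbert_C0_semigroup \<subseteq> C0_semigroup_on UNIV norm id 1 T
  using gen by unfold_locales (auto simp: generates_def csubspace_def norm_triangle_ineq)

context hilbert_C0_semigroup
begin

lemma A_eq: "A = generator UNIV norm T"
  using gen by (simp add: generates_def)

lemma T_bounded_op: "\<exists>K\<ge>0. \<forall>t. 0 \<le> t \<longrightarrow> t \<le> \<tau> \<longrightarrow> bounded_op K (T t)"
  using T_locally_bounded[of \<tau>] T_add T_scaleC unfolding bounded_op_def by auto

lemma continuous_on_T: "continuous_on {0..} (\<lambda>t. T t x)"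
  unfolding continuous_on_iff
proof (intro ballI allI impI)
  fix t e :: real assume "t \<in> {0..}" "e > 0"
  then show "\<exists>d>0. \<forall>s\<in>{0..}. dist s t < d \<longrightarrow> dist (T s x) (T t x) < e"
    using T_continuous[of x t e] by (auto simp: dist_norm)
qed

text \<open>The integrated semigroup. Its values for \<open>h \<ge> 0\<close> lie in the domain of
  \<open>A\<close>, and (1/r) R r x tends to \<open>x\<close>, which makes the domain dense. Its
  adjoint maps into the domain of the adjoint, which therefore separates points.\<close>

definition R :: "real \<Rightarrow> 'h \<Rightarrow> 'h" where
  "R h x = integral {0..h} (\<lambda>s. T s x)"

lemma T_integrable: "0 \<le> a \<Longrightarrow> (\<lambda>s. T s x) integrable_on {a..b}"
  by (rule integrable_continuous_real, rule continuous_on_subset[OF continuous_on_T]) auto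

lemma R_commute:
  assumes L: "bounded_op K L" and comm: "\<And>s. s \<ge> 0 \<Longrightarrow> L (T s x) = T s (L x)"
  shows "R h (L x) = L (R h x)"
proof -
  have "L (R h x) = integral {0..h} (L \<circ> (\<lambda>s. T s x))"
    unfolding R_def by (rule integral_linear[symmetric, OF T_integrable bounded_op_bounded_linear[OF L]]) simp
  also have "\<dots> = R h (L x)"
    unfolding R_def by (rule Henstock_Kurzweil_Integration.integral_cong) (simp add: comm)
  finally show ?thesis ..
qed

lemma R_bounded_op: "h \<ge> 0 \<Longrightarrow> \<exists>K. bounded_op K (R h)"
proof -
  assume h: "h \<ge> 0"
  obtain K where K: "K \<ge> 0" "\<And>t x. 0 \<le> t \<Longrightarrow> t \<le> h \<Longrightarrow> norm (T t x) \<le> K * norm x"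
    using T_locally_bounded[of h] by blast
  have "R h (x + y) = R h x + R h y" for x y
    unfolding R_def by (subst Henstock_Kurzweil_Integration.integral_add[symmetric])
      (auto intro!: T_integrable Henstock_Kurzweil_Integration.integral_cong simp: T_add)
  \<comment> \<open>The integral is handled as a real linear map; complex scalar multiplication is
    treated as one more bounded operator commuting with the semigroup.\<close>
  moreover have "R h (c *\<^sub>C x) = c *\<^sub>C R h x" for c x
  proof (rule R_commute)
    show "bounded_op (cmod c) ((*\<^sub>C) c)"
      by (simp add: bounded_op_def scaleC_add_right scaleC_scaleC mult.commute norm_scaleC)
  qed (simp add: T_scaleC)
  moreover have "norm (R h x) \<le> (K * h) * norm x" for x
  proof -
    have "norm (R h x) \<le> (K * norm x) * (h - 0)"
      unfolding R_def using h K
      by (intro integral_bound) (auto intro: continuous_on_subset[OF continuous_on_T])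
    then show ?thesis by (simp add: mult_ac)
  qed
  ultimately show ?thesis unfolding bounded_op_def by blast
qed

lemma R_average: "((\<lambda>r. (1 / r) *\<^sub>R R r x) \<longlongrightarrow> x) (at_right 0)"
  using integral_right_difference_quotient[OF continuous_on_T, of 0 x] by (simp add: R_def T_0)

lemma T_R_commute: "t \<ge> 0 \<Longrightarrow> T t (R h x) = R h (T t x)"
proof -
  assume t: "t \<ge> 0"
  obtain K where "bounded_op K (T t)" using T_bounded_op[of t] t by blast
  then show ?thesis
    using R_commute[of K "T t" x h] T_plus[OF t, of _ x] T_plus[OF _ t, of _ x]
    by (simp add: add.commute)
qed

text \<open>Applying \<open>T r\<close> shifts the window of integration from [0,h] to [r,h+r]; the
  change amounts to adding [h,h+r] and removing [0,r].\<close>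

lemma T_R_diff:
  assumes h: "h \<ge> 0" and r: "r \<ge> 0"
  shows "T r (R h x) - R h x = (R (h + r) x - R h x) - R r x"
proof -
  have "R h (T r x) = integral {0..h} ((\<lambda>s. T s x) \<circ> (+) r)"
    unfolding R_def
    by (rule Henstock_Kurzweil_Integration.integral_cong) (use r T_plus[of _ r x] in \<open>simp add: add.commute\<close>)
  also have "\<dots> = integral {r..h + r} (\<lambda>s. T s x)"
    by (simp add: integral_shift_Icc_real)
  also have "\<dots> = R (h + r) x - R r x"
    using Henstock_Kurzweil_Integration.integral_combine[OF r _ T_integrable[of 0 x "h + r"]] h
    by (simp add: R_def algebra_simps)
  finally show ?thesis by (simp add: T_R_commute[OF r])
qed

text \<open>Divided by \<open>r\<close>, the integrals over [h,h+r] and [0,r] tend to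
  \<open>T h x\<close> and \<open>x\<close>.\<close>

lemma R_in_domain:
  assumes h: "h \<ge> 0"
  shows "(R h x, T h x - x) \<in> A"
proof -
  have "((\<lambda>r. (1 / r) *\<^sub>R (R (h + r) x - R h x) - (1 / r) *\<^sub>R R r x) \<longlongrightarrow> T h x - x) (at_right 0)"
    using integral_right_difference_quotient[OF continuous_on_T h, of x]
    by (intro tendsto_diff R_average) (simp add: R_def)
  then have "((\<lambda>r. (1 / r) *\<^sub>R (T r (R h x) - R h x)) \<longlongrightarrow> T h x - x) (at_right 0)"
  proof (rule Lim_transform_eventually)
    show "\<forall>\<^sub>F r in at_right 0. (1 / r) *\<^sub>R (R (h + r) x - R h x) - (1 / r) *\<^sub>R R r x
        = (1 / r) *\<^sub>R (T r (R h x) - R h x)"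
      unfolding eventually_at_filter
      by (intro always_eventually allI impI) (simp add: T_R_diff[OF h] scaleR_right_diff_distrib)
  qed
  then show ?thesis
    unfolding A_eq generator_def by (simp add: LIM_zero tendsto_norm_zero)
qed

lemma A_unique: "(x, z) \<in> A \<Longrightarrow> (x, z') \<in> A \<Longrightarrow> z = z'"
  using generator_unique[of x z z'] by (simp add: A_eq)

lemma A_commute:
  assumes L: "bounded_op K L" and comm: "\<And>h x. h \<ge> 0 \<Longrightarrow> L (T h x) = T h (L x)" and "(x, z) \<in> A"
  shows "(L x, L z) \<in> A"
  unfolding A_eq
proof (rule generator_commute[where G = L and K = K])
  show "norm (L y) \<le> K * norm y" for y by (rule bounded_op_bound[OF L])
qed (use assms(3) in \<open>simp_all add: A_eq comm bounded_op_diff[OF L] bounded_op_scaleR[OF L]\<close>)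

text \<open>\<open>R h\<close> commutes with the semigroup, hence preserves the graph of
  \<open>A\<close>; comparison with the value given by \<open>R_in_domain\<close> yields the
  identity.\<close>

lemma R_A:
  assumes "h \<ge> 0" "(x, z) \<in> A"
  shows "R h z = T h x - x"
proof -
  obtain K where "bounded_op K (R h)" using R_bounded_op[OF assms(1)] by blast
  then have "(R h x, R h z) \<in> A"
    by (rule A_commute[OF _ _ assms(2)]) (simp add: T_R_commute)
  then show ?thesis using R_in_domain[OF assms(1)] A_unique by blast
qed

section \<open>The adjoint of the generator and its domain\<close>

lemma adjoint_graph_unique:
  assumes "(\<phi>, \<psi>) \<in> adjoint_graph A" "(\<phi>, \<psi>') \<in> adjoint_graph A"
  shows "\<psi> = \<psi>'"
proof -
  have 0: "cinner x (\<psi> - \<psi>') = 0" if "(x, z) \<in> A" for x z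
    using assms that by (fastforce simp: adjoint_graph_def cinner_diff_right)
  have "cinner x (\<psi> - \<psi>') = 0" for x
  proof -
    \<comment> \<open>The averages of an arbitrary \<open>x\<close> lie in the domain of
      \<open>A\<close> and converge to \<open>x\<close>: single-valuedness of the adjoint is density
      of the domain.\<close>
    have "((\<lambda>r. cinner ((1 / r) *\<^sub>R R r x) (\<psi> - \<psi>')) \<longlongrightarrow> cinner x (\<psi> - \<psi>')) (at_right 0)"
      by (rule bounded_linear.tendsto[OF bounded_linear_cinner_left R_average])
    moreover have "\<forall>\<^sub>F r in at_right 0. cinner ((1 / r) *\<^sub>R R r x) (\<psi> - \<psi>') = 0"
      unfolding eventually_at_filter
      by (intro always_eventually allI impI) (simp add: cinner_scaleR_left 0[OF R_in_domain])
    ultimately have "((\<lambda>r::real. 0) \<longlongrightarrow> cinner x (\<psi> - \<psi>')) (at_right 0)"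
      by (rule Lim_transform_eventually)
    then show ?thesis
      by (rule tendsto_unique[OF trivial_limit_at_right_real _ tendsto_const])
  qed
  then have "\<psi> - \<psi>' = 0" by (rule eq_zero_if_cinner_zero)
  then show ?thesis by simp
qed

lemma adjI:
  assumes "\<And>x z. (x, z) \<in> A \<Longrightarrow> cinner z \<phi> = cinner x \<psi>"
  shows "\<phi> \<in> dom_adj A" "adj A \<phi> = \<psi>"
proof -
  have mem: "(\<phi>, \<psi>) \<in> adjoint_graph A" using assms by (auto simp: adjoint_graph_def)
  then show "\<phi> \<in> dom_adj A" by (auto simp: dom_adj_def)
  show "adj A \<phi> = \<psi>"
    unfolding adj_def using mem adjoint_graph_unique by (intro the_equality) blast+
qed

lemma adj_mem: "\<phi> \<in> dom_adj A \<Longrightarrow> (\<phi>, adj A \<phi>) \<in> adjoint_graph A"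
proof -
  assume "\<phi> \<in> dom_adj A"
  then obtain \<psi> where "(\<phi>, \<psi>) \<in> adjoint_graph A" by (auto simp: dom_adj_def)
  moreover from this have "adj A \<phi> = \<psi>" by (intro adjI(2)) (auto simp: adjoint_graph_def)
  ultimately show ?thesis by simp
qed

lemma cinner_adj: "\<phi> \<in> dom_adj A \<Longrightarrow> (x, z) \<in> A \<Longrightarrow> cinner z \<phi> = cinner x (adj A \<phi>)"
  using adj_mem by (fastforce simp: adjoint_graph_def)

text \<open>A bounded operator commuting with the semigroup preserves the graph of \<open>A\<close>,
  so its adjoint preserves the graph of the adjoint. Used for \<open>T t\<close> and for e^{-As}
  P.\<close>

lemma adj_commute:
  assumes L: "bounded_op K L" and comm: "\<And>h x. h \<ge> 0 \<Longrightarrow> L (T h x) = T h (L x)"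
    and \<phi>: "\<phi> \<in> dom_adj A"
  shows "cadjoint L \<phi> \<in> dom_adj A" "adj A (cadjoint L \<phi>) = cadjoint L (adj A \<phi>)"
proof -
  have *: "cinner z (cadjoint L \<phi>) = cinner x (cadjoint L (adj A \<phi>))" if "(x, z) \<in> A" for x z
    using cinner_adj[OF \<phi> A_commute[OF L comm that]] by (simp add: cinner_cadjoint[OF L])
  show "cadjoint L \<phi> \<in> dom_adj A" by (rule adjI(1)[OF *])
  show "adj A (cadjoint L \<phi>) = cadjoint L (adj A \<phi>)" by (rule adjI(2)[OF *])
qed

text \<open>By \<open>R_A\<close>, the adjoint of \<open>R r\<close> maps all of H into
  \<open>dom_adj A\<close>. A vector orthogonal to \<open>dom_adj A\<close> is thus killed by every
  \<open>R r\<close>, and it is the limit of its own averages.\<close>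

lemma dom_adj_separating:
  assumes "\<And>\<phi>. \<phi> \<in> dom_adj A \<Longrightarrow> cinner y \<phi> = 0"
  shows "y = 0"
proof -
  have "R r y = 0" if r: "r \<ge> 0" for r
  proof -
    obtain K where K: "bounded_op K (R r)" using R_bounded_op[OF r] by blast
    obtain K' where K': "bounded_op K' (T r)" using T_bounded_op[of r] r by blast
    have "cinner z (cadjoint (R r) \<phi>) = cinner x (cadjoint (T r) \<phi> - \<phi>)" if "(x, z) \<in> A" for x z \<phi>
      by (simp add: cinner_cadjoint[OF K, symmetric] R_A[OF r that] cinner_diff_left
          cinner_diff_right cinner_cadjoint[OF K'])
    then have "cadjoint (R r) \<phi> \<in> dom_adj A" for \<phi> by (rule adjI(1))
    then have "cinner (R r y) \<phi> = 0" for \<phi>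
      by (simp add: cinner_cadjoint[OF K] assms)
    then show ?thesis by (metis eq_zero_if_cinner_zero cinner_commute complex_cnj_zero)
  qed
  then have "((\<lambda>r::real. (1 / r) *\<^sub>R R r y) \<longlongrightarrow> 0) (at_right 0)"
    by (intro tendsto_eventually) (auto simp: eventually_at_right_field intro: exI[of _ 1])
  then show "y = 0" using R_average[of y] tendsto_unique[OF trivial_limit_at_right_real] by blast
qed

lemma zero_in_dom_adj: "0 \<in> dom_adj A" "adj A 0 = 0"
  using adjI[of 0 0] by simp_all

lemma add_in_dom_adj:
  assumes "\<phi> \<in> dom_adj A" "\<psi> \<in> dom_adj A"
  shows "\<phi> + \<psi> \<in> dom_adj A" "adj A (\<phi> + \<psi>) = adj A \<phi> + adj A \<psi>"
  using adjI[of "\<phi> + \<psi>" "adj A \<phi> + adj A \<psi>"] by (simp_all add: cinner_add_right cinner_adj assms)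

lemma scaleC_in_dom_adj:
  assumes "\<phi> \<in> dom_adj A"
  shows "a *\<^sub>C \<phi> \<in> dom_adj A" "adj A (a *\<^sub>C \<phi>) = a *\<^sub>C adj A \<phi>"
  using adjI[of "a *\<^sub>C \<phi>" "a *\<^sub>C adj A \<phi>"] by (simp_all add: cinner_scaleC_right cinner_adj assms)

lemma graph_norm_eq: "graph_norm A \<phi> = norm (\<phi>, adj A \<phi>)"
  by (simp add: graph_norm_def norm_prod_def)

lemma graph_norm_scaleC: "\<phi> \<in> dom_adj A \<Longrightarrow> graph_norm A (a *\<^sub>C \<phi>) = cmod a * graph_norm A \<phi>"
proof -
  assume "\<phi> \<in> dom_adj A"
  then have "graph_norm A (a *\<^sub>C \<phi>) = sqrt ((cmod a)\<^sup>2 * ((norm \<phi>)\<^sup>2 + (norm (adj A \<phi>))\<^sup>2))"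
    by (simp add: graph_norm_def scaleC_in_dom_adj norm_scaleC power_mult_distrib distrib_left)
  then show ?thesis by (simp add: real_sqrt_mult graph_norm_def)
qed

lemma graph_norm_nonneg: "graph_norm A \<phi> \<ge> 0"
  by (simp add: graph_norm_def)

lemma norm_le_graph_norm: "norm \<phi> \<le> graph_norm A \<phi>" "norm (adj A \<phi>) \<le> graph_norm A \<phi>"
  by (simp_all add: graph_norm_def real_le_rsqrt)

lemma graph_norm_cadjoint_le:
  assumes L: "bounded_op K L" and comm: "\<And>h x. h \<ge> 0 \<Longrightarrow> L (T h x) = T h (L x)"
    and \<phi>: "\<phi> \<in> dom_adj A"
  shows "graph_norm A (cadjoint L \<phi>) \<le> K * graph_norm A \<phi>"
proof (cases "K \<ge> 0")
  case True
  have "graph_norm A (cadjoint L \<phi>) \<le> sqrt ((K * norm \<phi>)\<^sup>2 + (K * norm (adj A \<phi>))\<^sup>2)"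
    unfolding graph_norm_def
    by (intro real_sqrt_le_mono add_mono power_mono norm_cadjoint_le[OF L])
      (auto simp: adj_commute(2)[OF assms] norm_cadjoint_le[OF L])
  also have "\<dots> = sqrt (K\<^sup>2 * ((norm \<phi>)\<^sup>2 + (norm (adj A \<phi>))\<^sup>2))"
    by (simp add: power_mult_distrib distrib_left)
  also have "\<dots> = K * graph_norm A \<phi>" using True by (simp add: real_sqrt_mult graph_norm_def)
  finally show ?thesis .
next
  case False
  \<comment> \<open>A negative bound is possible only when every vector vanishes.\<close>
  have "\<phi> = 0"
  proof (rule ccontr)
    assume "\<phi> \<noteq> 0"
    then have "K * norm \<phi> < 0" using False by (simp add: mult_less_0_iff)
    then show False using norm_cadjoint_le[OF L, of \<phi>] norm_ge_zero[of "cadjoint L \<phi>"] by linarith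
  qed
  moreover have "cadjoint L 0 = 0" using norm_cadjoint_le[OF L, of 0] by simp
  ultimately show ?thesis by (simp add: graph_norm_def zero_in_dom_adj)
qed

end

section \<open>The extended semigroup on the dual of the domain of the adjoint\<close>

context hilbert_C0_semigroup
begin

text \<open>The pair \<open>(a, b)\<close> stands for the embedded \<open>a\<close> plus the
  extended generator applied to \<open>b\<close>. Such functionals exhaust the dual, so H x H serves
  as its Banach model.\<close>

definition ext_pair :: "'h \<times> 'h \<Rightarrow> 'h \<Rightarrow> complex" where
  "ext_pair p = (\<lambda>\<phi>. if \<phi> \<in> dom_adj A then cinner (fst p) \<phi> + cinner (snd p) (adj A \<phi>) else 0)"

lemma dual_outside: "f \<in> dual_dom A \<Longrightarrow> \<phi> \<notin> dom_adj A \<Longrightarrow> f \<phi> = 0"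
  and dual_add: "f \<in> dual_dom A \<Longrightarrow> \<phi> \<in> dom_adj A \<Longrightarrow> \<psi> \<in> dom_adj A \<Longrightarrow> f (\<phi> + \<psi>) = f \<phi> + f \<psi>"
  and dual_scaleC: "f \<in> dual_dom A \<Longrightarrow> \<phi> \<in> dom_adj A \<Longrightarrow> f (a *\<^sub>C \<phi>) = cnj a * f \<phi>"
  and dual_bounded: "f \<in> dual_dom A \<Longrightarrow> \<exists>K. \<forall>\<phi>\<in>dom_adj A. cmod (f \<phi>) \<le> K * graph_norm A \<phi>"
  by (auto simp: dual_dom_def)

lemma dual_zero: "f \<in> dual_dom A \<Longrightarrow> f 0 = 0"
  using dual_scaleC[of f 0 0] zero_in_dom_adj(1) by (metis complex_cnj_zero mult_zero_left scaleC_of_real of_real_0 scaleR_zero_left)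

lemma graph_norm_eq_0: "graph_norm A \<phi> = 0 \<Longrightarrow> \<phi> = 0"
  using norm_le_graph_norm(1)[of \<phi>] by simp

lemma dual_norm_le:
  assumes "K \<ge> 0" "\<And>\<phi>. \<phi> \<in> dom_adj A \<Longrightarrow> cmod (f \<phi>) \<le> K * graph_norm A \<phi>"
  shows "dual_norm A f \<le> K"
  unfolding dual_norm_def
proof (rule cSup_least)
  have "graph_norm A 0 \<le> 1" by (simp add: graph_norm_def zero_in_dom_adj)
  then show "{cmod (f \<phi>) |\<phi>. \<phi> \<in> dom_adj A \<and> graph_norm A \<phi> \<le> 1} \<noteq> {}"
    using zero_in_dom_adj(1) by blast
  show "x \<le> K" if "x \<in> {cmod (f \<phi>) |\<phi>. \<phi> \<in> dom_adj A \<and> graph_norm A \<phi> \<le> 1}" for x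
    using that assms(2) mult_left_le[OF _ assms(1)] by (force intro: order_trans)
qed

lemma dual_bound:
  assumes f: "f \<in> dual_dom A" and \<phi>: "\<phi> \<in> dom_adj A"
  shows "cmod (f \<phi>) \<le> dual_norm A f * graph_norm A \<phi>"
proof (cases "graph_norm A \<phi> = 0")
  case True
  then show ?thesis using graph_norm_eq_0[OF True] dual_zero[OF f] by simp
next
  case False
  then have g: "graph_norm A \<phi> > 0" using graph_norm_nonneg[of \<phi>] by simp
  define \<psi> where "\<psi> = of_real (1 / graph_norm A \<phi>) *\<^sub>C \<phi>"
  have \<psi>: "\<psi> \<in> dom_adj A" "graph_norm A \<psi> \<le> 1"
    using \<phi> g by (simp_all add: \<psi>_def scaleC_in_dom_adj graph_norm_scaleC norm_divide)
  obtain K where K: "\<And>\<phi>. \<phi> \<in> dom_adj A \<Longrightarrow> cmod (f \<phi>) \<le> K * graph_norm A \<phi>"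
    using dual_bounded[OF f] by blast
  have "cmod (f \<psi>) \<le> dual_norm A f"
    unfolding dual_norm_def
  proof (rule cSup_upper)
    show "bdd_above {cmod (f \<phi>) |\<phi>. \<phi> \<in> dom_adj A \<and> graph_norm A \<phi> \<le> 1}"
    proof (rule bdd_aboveI)
      fix x assume "x \<in> {cmod (f \<phi>) |\<phi>. \<phi> \<in> dom_adj A \<and> graph_norm A \<phi> \<le> 1}"
      then obtain \<xi> where \<xi>: "x = cmod (f \<xi>)" "\<xi> \<in> dom_adj A" "graph_norm A \<xi> \<le> 1" by blast
      have "x \<le> K * graph_norm A \<xi>" using K \<xi> by simp
      also have "\<dots> \<le> \<bar>K\<bar> * graph_norm A \<xi>" by (rule mult_right_mono) (simp_all add: graph_norm_nonneg)
      also have "\<dots> \<le> \<bar>K\<bar> * 1" by (rule mult_left_mono) (simp_all add: \<xi>)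
      finally show "x \<le> \<bar>K\<bar>" by simp
    qed
  qed (use \<psi> in blast)
  moreover have "cmod (f \<psi>) = cmod (f \<phi>) / graph_norm A \<phi>"
    using g by (simp add: \<psi>_def dual_scaleC[OF f \<phi>] norm_mult norm_divide)
  ultimately show ?thesis using g by (simp add: divide_le_eq)
qed

lemma dual_norm_nonneg: "f \<in> dual_dom A \<Longrightarrow> dual_norm A f \<ge> 0"
proof (cases "\<exists>\<phi>\<in>dom_adj A. graph_norm A \<phi> > 0")
  case True
  assume f: "f \<in> dual_dom A"
  from True obtain \<phi> where "\<phi> \<in> dom_adj A" "graph_norm A \<phi> > 0" by blast
  then show ?thesis
    using order_trans[OF norm_ge_zero dual_bound[OF f]] by (force simp: zero_le_mult_iff)
next
  case False
  assume f: "f \<in> dual_dom A"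
  have "graph_norm A 0 = 0" by (simp add: graph_norm_def zero_in_dom_adj)
  have *: "\<phi> = 0" if "\<phi> \<in> dom_adj A" for \<phi>
    using False that graph_norm_nonneg[of \<phi>] graph_norm_eq_0[of \<phi>] by fastforce
  have "{cmod (f \<phi>) |\<phi>. \<phi> \<in> dom_adj A \<and> graph_norm A \<phi> \<le> 1} = {0}"
    using * zero_in_dom_adj(1) dual_zero[OF f] \<open>graph_norm A 0 = 0\<close>
    by (force intro!: exI[of _ "0::'h"])
  then show ?thesis by (simp add: dual_norm_def)
qed

lemma ext_pair_bound:
  assumes "\<phi> \<in> dom_adj A"
  shows "cmod (ext_pair p \<phi>) \<le> (norm (fst p) + norm (snd p)) * graph_norm A \<phi>"
proof -
  have "cmod (ext_pair p \<phi>) \<le> norm (fst p) * norm \<phi> + norm (snd p) * norm (adj A \<phi>)"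
    using assms norm_triangle_ineq[of "cinner (fst p) \<phi>" "cinner (snd p) (adj A \<phi>)"]
      cmod_cinner_le[of "fst p" \<phi>] cmod_cinner_le[of "snd p" "adj A \<phi>"]
    by (simp add: ext_pair_def)
  also have "\<dots> \<le> norm (fst p) * graph_norm A \<phi> + norm (snd p) * graph_norm A \<phi>"
    by (intro add_mono mult_left_mono norm_le_graph_norm) auto
  finally show ?thesis by (simp add: distrib_right)
qed

lemma ext_pair_in_dual: "ext_pair p \<in> dual_dom A"
  unfolding dual_dom_def
  using ext_pair_bound[of _ p]
  by (auto simp: ext_pair_def add_in_dom_adj scaleC_in_dom_adj cinner_add_right cinner_scaleC_right
      distrib_left)

lemma dual_norm_ext_pair: "dual_norm A (ext_pair p) \<le> norm (fst p) + norm (snd p)"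
  by (rule dual_norm_le) (auto simp: ext_pair_bound)

lemma embed_ext_pair: "embed A x = ext_pair (x, 0)"
  by (auto simp: embed_def ext_pair_def fun_eq_iff)

lemma embed_in_dual: "embed A x \<in> dual_dom A"
  by (simp add: embed_ext_pair ext_pair_in_dual)

lemma dual_norm_embed: "dual_norm A (embed A x) \<le> norm x"
  using dual_norm_ext_pair[of "(x, 0)"] by (simp add: embed_ext_pair)

lemma ext_pair_add: "ext_pair (p + q) = ext_pair p + ext_pair q"
  by (auto simp: ext_pair_def fun_eq_iff cinner_add_left)

lemma ext_pair_scaleR: "ext_pair (c *\<^sub>R p) = c *\<^sub>R ext_pair p"
  by (auto simp: ext_pair_def fun_eq_iff cinner_scaleR_left scaleR_fun_def scaleR_conv_of_real distrib_left)

lemma embed_add: "embed A (x + y) = embed A x + embed A y"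
  using ext_pair_add[of "(x, 0)" "(y, 0)"] by (simp add: embed_ext_pair)

lemma embed_scaleR: "embed A (c *\<^sub>R x) = c *\<^sub>R embed A x"
  using ext_pair_scaleR[of c "(x, 0)"] by (simp add: embed_ext_pair)

lemma embed_diff: "embed A (x - y) = embed A x - embed A y"
  by (auto simp: embed_def fun_eq_iff cinner_diff_left)

lemma embed_inject: "embed A x = embed A y \<Longrightarrow> x = y"
  using dom_adj_separating[of "x - y"]
  by (simp add: embed_def fun_eq_iff cinner_diff_left) (metis (full_types) eq_iff_diff_eq_0)

section \<open>Riesz representation on the graph of the adjoint\<close>

lemma closed_adjoint_graph: "closed (adjoint_graph A)"
proof -
  have cont: "continuous_on UNIV (\<lambda>p. cinner z (fst p) - cinner x (snd p))" for x z
  proof -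
    \<comment> \<open>Conjugation moves the variable into the first argument, where continuity has
      been established.\<close>
    have eq: "(\<lambda>p. cinner z (fst p) - cinner x (snd p))
        = (\<lambda>p. cnj (cinner (fst p) z) - cnj (cinner (snd p) x))"
      using cinner_commute by (metis (no_types, lifting))
    show ?thesis unfolding eq
      by (intro continuous_intros bounded_linear.continuous_on[OF bounded_linear_cinner_left])
  qed
  have "adjoint_graph A = (\<Inter>(x, z)\<in>A. (\<lambda>p. cinner z (fst p) - cinner x (snd p)) -` {0})"
    by (auto simp: adjoint_graph_def)
  also have "closed \<dots>"
    using cont by (intro closed_INT ballI)
      (auto intro!: continuous_closed_vimage simp: continuous_on_eq_continuous_at[OF open_UNIV])
  finally show ?thesis .
qed

text \<open>On the closed graph of the adjoint the norm of H x H is the graph norm, so real Riesz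
  representation applies to the real part of \<open>f\<close>. Both functionals are antilinear, and
  evaluation at \<open>\<i> *\<^sub>C \<phi>\<close> recovers the imaginary part.\<close>

lemma ext_pair_onto:
  assumes f: "f \<in> dual_dom A"
  shows "\<exists>p. ext_pair p = f \<and> norm p \<le> dual_norm A f"
proof -
  let ?V = "adjoint_graph A"
  have V: "q \<in> ?V \<longleftrightarrow> fst q \<in> dom_adj A \<and> snd q = adj A (fst q)" for q
    using adj_mem[of "fst q"] adjoint_graph_unique[of "fst q" "snd q"]
    by (cases q) (auto simp: dom_adj_def)
  have scaleR_mem: "c *\<^sub>R \<phi> \<in> dom_adj A" "adj A (c *\<^sub>R \<phi>) = c *\<^sub>R adj A \<phi>"
      "f (c *\<^sub>R \<phi>) = c *\<^sub>R f \<phi>" if "\<phi> \<in> dom_adj A" for \<phi> c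
    using scaleC_in_dom_adj[OF that, of "of_real c"] dual_scaleC[OF f that, of "of_real c"]
    by (simp_all add: scaleC_of_real scaleR_conv_of_real)
  have "\<exists>p\<in>?V. \<forall>q\<in>?V. Re (f (fst q)) = inner p q"
  proof (rule riesz_on_closed_subspace[OF closed_adjoint_graph])
    show "subspace ?V"
      unfolding subspace_def by (auto simp: V zero_in_dom_adj add_in_dom_adj scaleR_mem)
    show "\<bar>Re (f (fst q))\<bar> \<le> dual_norm A f * norm q" if "q \<in> ?V" for q
      using that dual_bound[OF f, of "fst q"] abs_Re_le_cmod[of "f (fst q)"]
      by (cases q) (simp add: V graph_norm_eq)
  qed (simp_all add: V dual_add[OF f] scaleR_mem)
  then obtain p where p: "p \<in> ?V" "\<And>q. q \<in> ?V \<Longrightarrow> Re (f (fst q)) = inner p q" by blast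
  have re: "Re (f \<phi>) = Re (ext_pair p \<phi>)" if "\<phi> \<in> dom_adj A" for \<phi>
    using p(2)[of "(\<phi>, adj A \<phi>)"] that by (simp add: V ext_pair_def inner_prod_def inner_eq_Re_cinner)
  have "f \<phi> = ext_pair p \<phi>" if \<phi>: "\<phi> \<in> dom_adj A" for \<phi>
  proof -
    have "Im (f \<phi>) = Im (ext_pair p \<phi>)"
      using re[OF scaleC_in_dom_adj(1)[OF \<phi>, of "\<i>"]] \<phi>
      by (simp add: dual_scaleC[OF f] dual_scaleC[OF ext_pair_in_dual])
    then show ?thesis using re[OF \<phi>] by (simp add: complex_eq_iff)
  qed
  moreover have "f \<phi> = ext_pair p \<phi>" if "\<phi> \<notin> dom_adj A" for \<phi>
    using that dual_outside[OF f] by (simp add: ext_pair_def)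
  ultimately have eq: "ext_pair p = f" by (metis ext)
  have "norm p * norm p = Re (f (fst p))"
    using p by (simp add: power2_norm_eq_inner[symmetric] power2_eq_square)
  also have "\<dots> \<le> dual_norm A f * norm p"
    using p(1) dual_bound[OF f, of "fst p"] complex_Re_le_cmod[of "f (fst p)"]
    by (cases p) (simp add: V graph_norm_eq)
  finally have "norm p \<le> dual_norm A f"
    using dual_norm_nonneg[OF f] by (cases "p = 0") (simp_all add: mult_le_cancel_right)
  then show ?thesis using eq by blast
qed

end

text \<open>The constant 2 bounds the sum of the two component norms by the norm of the pair; the
  same constant also covers the reverse estimate from \<open>ext_pair_onto\<close>.\<close>

sublocale hilbert_C0_semigroup \<subseteq> dual: banach_image "dual_dom A" "dual_norm A" ext_pair 2
proof
  show "ext_pair b \<in> dual_dom A" for b by (rule ext_pair_in_dual)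
  show "csubspace (dual_dom A)"
  proof -
    have "f + g \<in> dual_dom A" if "f \<in> dual_dom A" "g \<in> dual_dom A" for f g
      using that ext_pair_onto ext_pair_add ext_pair_in_dual by metis
    moreover have "a *\<^sub>C f \<in> dual_dom A" if f: "f \<in> dual_dom A" for f a
    proof -
      have "cmod ((a *\<^sub>C f) \<phi>) \<le> (cmod a * dual_norm A f) * graph_norm A \<phi>" if "\<phi> \<in> dom_adj A" for \<phi>
        using mult_left_mono[OF dual_bound[OF f that], of "cmod a"]
        by (simp add: scaleC_fun_def scaleC_complex_def norm_mult mult_ac)
      then show ?thesis
        unfolding dual_dom_def mem_Collect_eq using f
        by (intro conjI exI[of _ "cmod a * dual_norm A f"] ballI)
          (auto simp: scaleC_fun_def scaleC_complex_def dual_outside dual_add dual_scaleC distrib_left)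
    qed
    moreover have "0 \<in> dual_dom A" using ext_pair_in_dual[of 0] by (simp add: ext_pair_def zero_fun_def cong: if_cong)
    ultimately show ?thesis by (simp add: csubspace_def)
  qed
  show "dual_norm A (f + g) \<le> dual_norm A f + dual_norm A g" if "f \<in> dual_dom A" "g \<in> dual_dom A" for f g
  proof (rule dual_norm_le)
    fix \<phi> assume "\<phi> \<in> dom_adj A"
    then show "cmod ((f + g) \<phi>) \<le> (dual_norm A f + dual_norm A g) * graph_norm A \<phi>"
      using norm_triangle_ineq[of "f \<phi>" "g \<phi>"] dual_bound[OF that(1)] dual_bound[OF that(2)]
      by (fastforce simp: distrib_right)
  qed (simp add: that dual_norm_nonneg)
  have scale_le: "dual_norm A (c *\<^sub>R f) \<le> \<bar>c\<bar> * dual_norm A f" if "f \<in> dual_dom A" for c f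
  proof (rule dual_norm_le)
    fix \<phi> assume "\<phi> \<in> dom_adj A"
    from mult_left_mono[OF dual_bound[OF that this], of "\<bar>c\<bar>"]
    show "cmod ((c *\<^sub>R f) \<phi>) \<le> (\<bar>c\<bar> * dual_norm A f) * graph_norm A \<phi>"
      by (simp add: scaleR_fun_def mult_ac)
  qed (simp add: that dual_norm_nonneg)
  show "dual_norm A (c *\<^sub>R f) = \<bar>c\<bar> * dual_norm A f" if f: "f \<in> dual_dom A" for c f
  proof (cases "c = 0")
    case True
    then show ?thesis using scale_le[OF f, of 0] dual_norm_nonneg[OF ext_pair_in_dual[of 0]] ext_pair_scaleR[of 0 0]
      by (metis abs_zero antisym mult_zero_left scaleR_zero_left)
  next
    case False
    have cf: "c *\<^sub>R f \<in> dual_dom A" using f ext_pair_onto ext_pair_scaleR ext_pair_in_dual by metis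
    have "dual_norm A f \<le> \<bar>1 / c\<bar> * dual_norm A (c *\<^sub>R f)"
      using scale_le[OF cf, of "1 / c"] False by simp
    then show ?thesis using scale_le[OF f, of c] False by (simp add: field_simps)
  qed
  show "dual_norm A (ext_pair b) \<le> 2 * norm b" for b
    using dual_norm_ext_pair[of b] norm_fst_le[of "fst b" "snd b"] norm_snd_le[of "snd b" "fst b"] by simp
  show "\<exists>b. ext_pair b = f \<and> norm b \<le> 2 * dual_norm A f" if "f \<in> dual_dom A" for f
    using ext_pair_onto[OF that] dual_norm_nonneg[OF that] by force
qed (simp_all add: ext_pair_add ext_pair_scaleR)

text \<open>\<open>S\<close> is specified by its generator alone; its action on embedded vectors is
  a consequence.\<close>

locale extended_C0_semigroup = hilbert_C0_semigroup A T
  for A :: "('h::complex_hilbert \<times> 'h) set" and T :: "real \<Rightarrow> 'h \<Rightarrow> 'h" +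
  fixes S :: "real \<Rightarrow> ('h \<Rightarrow> complex) \<Rightarrow> 'h \<Rightarrow> complex"
  assumes gen_S: "generates (dual_dom A) (dual_norm A) (extended_op A) S"

sublocale extended_C0_semigroup \<subseteq> S: C0_semigroup_on "dual_dom A" "dual_norm A" ext_pair 2 S
  using gen_S by unfold_locales (simp add: generates_def)

section \<open>The extended semigroup as the transpose of the adjoint semigroup\<close>

context extended_C0_semigroup
begin

lemma extended_op_eq: "generator (dual_dom A) (dual_norm A) S = extended_op A"
  using gen_S by (simp add: generates_def)

lemma extended_op_iff: "(f, g) \<in> extended_op A \<longleftrightarrow> (\<exists>x. f = embed A x \<and> g = ext_pair (0, x))"
  by (auto simp: extended_op_def ext_pair_def cong: if_cong)

lemma extended_op_embed: "(x, z) \<in> A \<Longrightarrow> (embed A x, embed A z) \<in> extended_op A"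
  unfolding extended_op_iff
  by (intro exI[of _ x]) (auto simp: embed_def ext_pair_def fun_eq_iff cinner_adj)

text \<open>Uniqueness of the abstract Cauchy problem: \<open>s \<mapsto> S (t - s) (T s x)\<close> has zero right derivative.\<close>
lemma S_embed_domain:
  assumes t: "t \<ge> 0" and x: "(x, z) \<in> A"
  shows "S t (embed A x) = embed A (T t x)"
proof
  fix \<phi>
  note in_dual = embed_in_dual dual.X_diff S.T_in dual.X_scaleR
  show "S t (embed A x) \<phi> = embed A (T t x) \<phi>"
  proof (cases "\<phi> \<in> dom_adj A")
    case \<phi>: True
    \<comment> \<open>Evaluation at \<open>\<phi>\<close> makes the comparison scalar, since the
      dual is not a normed type.\<close>
    define w where "w s = S (t - s) (embed A (T s x)) \<phi>" for s
    obtain K where K: "K \<ge> 0"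
      "\<And>s f. 0 \<le> s \<Longrightarrow> s \<le> t \<Longrightarrow> f \<in> dual_dom A \<Longrightarrow> dual_norm A (S s f) \<le> K * dual_norm A f"
      using S.T_locally_bounded[of t] by blast
    have eval: "norm (f \<phi> - g \<phi>) \<le> dual_norm A (f - g) * graph_norm A \<phi>"
      if "f \<in> dual_dom A" "g \<in> dual_dom A" for f g
      using dual_bound[OF dual.X_diff[OF that] \<phi>] by simp
    have "w t = w 0"
    proof (rule constant_if_zero_right_derivative[OF t])
      show "continuous_on {0..t} w"
        unfolding continuous_on_def
      proof
        fix s0 assume s0: "s0 \<in> {0..t}"
        \<comment> \<open>Freezing the state at \<open>s0\<close> separates the change of the state
          from the change of the operator.\<close>
        define f0 where "f0 = embed A (T s0 x)"
        have "((\<lambda>s. w s - w s0) \<longlongrightarrow> 0) (at s0 within {0..t})"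
        proof (rule Lim_null_comparison)
          have "((\<lambda>s. norm (T s x - T s0 x)) \<longlongrightarrow> 0) (at s0 within {0..t})"
            by (rule tendsto_mono[OF at_le T_tendsto]) (use s0 in auto)
          moreover have "((\<lambda>s. dual_norm A (S (t - s) f0 - S (t - s0) f0)) \<longlongrightarrow> 0) (at s0 within {0..t})"
          proof (rule filterlim_compose[OF S.T_tendsto[of f0 "t - s0"]])
            show "filterlim ((-) t) (at (t - s0) within {0..}) (at s0 within {0..t})"
              unfolding filterlim_at by (intro conjI tendsto_intros) (auto simp: eventually_at_filter)
          qed (use s0 in \<open>auto simp: f0_def embed_in_dual\<close>)
          ultimately have "((\<lambda>s. (K * norm (T s x - T s0 x) + dual_norm A (S (t - s) f0 - S (t - s0) f0))
              * graph_norm A \<phi>) \<longlongrightarrow> (K * 0 + 0) * graph_norm A \<phi>) (at s0 within {0..t})"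
            by (intro tendsto_intros)
          then show "((\<lambda>s. (K * norm (T s x - T s0 x) + dual_norm A (S (t - s) f0 - S (t - s0) f0))
              * graph_norm A \<phi>) \<longlongrightarrow> 0) (at s0 within {0..t})" by simp
          have "norm (w s - w s0)
              \<le> (K * norm (T s x - T s0 x) + dual_norm A (S (t - s) f0 - S (t - s0) f0)) * graph_norm A \<phi>"
            if s: "s \<in> {0..t}" for s
          proof -
            have eq: "S (t - s) (embed A (T s x)) - S (t - s) f0 = S (t - s) (embed A (T s x - T s0 x))"
              using s by (simp add: f0_def S.T_diff in_dual embed_diff)
            have tri: "dual_norm A (S (t - s) (embed A (T s x)) - S (t - s0) f0)
                \<le> dual_norm A (S (t - s) (embed A (T s x)) - S (t - s) f0)
                  + dual_norm A (S (t - s) f0 - S (t - s0) f0)"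
              using s s0 by (intro dual.N_triangle_diff) (auto simp: f0_def in_dual)
            have "dual_norm A (S (t - s) (embed A (T s x)) - S (t - s) f0)
                \<le> K * dual_norm A (embed A (T s x - T s0 x))"
              unfolding eq by (rule K(2)) (use s in \<open>auto simp: in_dual\<close>)
            also have "\<dots> \<le> K * norm (T s x - T s0 x)"
              by (rule mult_left_mono[OF dual_norm_embed K(1)])
            finally have "dual_norm A (S (t - s) (embed A (T s x)) - S (t - s) f0) \<le> K * norm (T s x - T s0 x)" .
            from mult_right_mono[OF order_trans[OF tri add_right_mono[OF this]] graph_norm_nonneg[of \<phi>]]
            show ?thesis
              using eval[of "S (t - s) (embed A (T s x))" "S (t - s0) f0"] s s0
              by (simp add: w_def f0_def in_dual)
          qed
          then show "\<forall>\<^sub>F s in at s0 within {0..t}. norm (w s - w s0)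
              \<le> (K * norm (T s x - T s0 x) + dual_norm A (S (t - s) f0 - S (t - s0) f0)) * graph_norm A \<phi>"
            unfolding eventually_at_filter by (intro always_eventually) blast
        qed
        then show "(w \<longlongrightarrow> w s0) (at s0 within {0..t})" by (simp add: LIM_zero_iff)
      qed
    next
      fix s assume s: "0 \<le> s" "s < t"
      define y where "y = T s x"
      define v where "v = T s z"
      have yv: "(y, v) \<in> A"
        using generator_invariant[OF x[unfolded A_eq] s(1)] by (simp add: A_eq y_def v_def)
      \<comment> \<open>Both difference quotients approximate the same vector \<open>v\<close>, one
        in H and one after embedding; \<open>q1\<close> and \<open>q2\<close> measure the two
        errors.\<close>
      define q1 where "q1 h = norm ((1 / h) *\<^sub>R (T h y - y) - v)" for h
      define q2 where "q2 h = dual_norm A ((1 / h) *\<^sub>R (S h (embed A y) - embed A y) - embed A v)" for h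
      show "((\<lambda>h. norm (w (s + h) - w s) / h) \<longlongrightarrow> 0) (at_right 0)"
      proof (rule Lim_null_comparison)
        have "(q1 \<longlongrightarrow> 0) (at_right 0)"
          using yv unfolding A_eq q1_def by (simp add: generator_def)
        moreover have "(q2 \<longlongrightarrow> 0) (at_right 0)"
          using extended_op_embed[OF yv] unfolding extended_op_eq[symmetric] q2_def
          by (simp add: generator_def)
        ultimately have "((\<lambda>h. K * (q1 h + q2 h) * graph_norm A \<phi>) \<longlongrightarrow> K * (0 + 0) * graph_norm A \<phi>) (at_right 0)"
          by (intro tendsto_intros)
        then show "((\<lambda>h. K * (q1 h + q2 h) * graph_norm A \<phi>) \<longlongrightarrow> 0) (at_right 0)" by simp
        have "norm (norm (w (s + h) - w s) / h) \<le> K * (q1 h + q2 h) * graph_norm A \<phi>"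
          if h: "0 < h" "h < t - s" for h
        proof -
          have r: "0 \<le> t - (s + h)" "t - (s + h) \<le> t" "0 \<le> h" "0 \<le> t - s" using h s by auto
          have w1: "w (s + h) = S (t - (s + h)) (embed A (T h y)) \<phi>"
            using T_plus[of h s x] h s by (simp add: w_def y_def add.commute)
          \<comment> \<open>Splitting off \<open>S h\<close> gives both terms the common outer
            factor \<open>S (t - (s + h))\<close>, so that only the vector \<open>g\<close> has to
            be estimated.\<close>
          have w2: "w s = S (t - (s + h)) (S h (embed A y)) \<phi>"
            using S.T_plus[OF r(1,3) embed_in_dual, of y] h s by (simp add: w_def y_def)
          define g where "g = embed A (T h y) - S h (embed A y)"
          have g: "g \<in> dual_dom A" using h by (simp add: g_def in_dual)
          have "norm (w (s + h) - w s)
              \<le> dual_norm A (S (t - (s + h)) (embed A (T h y)) - S (t - (s + h)) (S h (embed A y))) * graph_norm A \<phi>"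
            unfolding w1 w2 using r by (intro eval) (simp_all add: in_dual)
          also have "S (t - (s + h)) (embed A (T h y)) - S (t - (s + h)) (S h (embed A y)) = S (t - (s + h)) g"
            using r by (simp add: g_def S.T_diff in_dual)
          also have "dual_norm A (S (t - (s + h)) g) * graph_norm A \<phi> \<le> (K * dual_norm A g) * graph_norm A \<phi>"
            by (intro mult_right_mono K(2) r g graph_norm_nonneg)
          finally have *: "norm (w (s + h) - w s) / h \<le> K * (dual_norm A g / h) * graph_norm A \<phi>"
            using h by (simp add: divide_le_eq)
          have "dual_norm A g / h = dual_norm A ((1 / h) *\<^sub>R g)"
            using h g by (simp add: dual.N_scale)
          \<comment> \<open>The base point \<open>embed A y\<close> and the limit
            \<open>embed A v\<close> cancel between the two errors.\<close>
          also have "(1 / h) *\<^sub>R g = embed A ((1 / h) *\<^sub>R (T h y - y) - v)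
              - ((1 / h) *\<^sub>R (S h (embed A y) - embed A y) - embed A v)"
            by (simp add: g_def embed_diff embed_scaleR scaleR_right_diff_distrib)
          also have "dual_norm A \<dots> \<le> dual_norm A (embed A ((1 / h) *\<^sub>R (T h y - y) - v)) + q2 h"
            unfolding q2_def using r by (intro dual.N_diff_le) (simp_all add: in_dual)
          also have "\<dots> \<le> q1 h + q2 h"
            unfolding q1_def by (intro add_right_mono dual_norm_embed)
          finally have "K * (dual_norm A g / h) * graph_norm A \<phi> \<le> K * (q1 h + q2 h) * graph_norm A \<phi>"
            by (intro mult_right_mono mult_left_mono K(1) graph_norm_nonneg)
          then show ?thesis using * h by simp
        qed
        then show "\<forall>\<^sub>F h in at_right 0. norm (norm (w (s + h) - w s) / h) \<le> K * (q1 h + q2 h) * graph_norm A \<phi>"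
          using s unfolding eventually_at_right_field by (intro exI[of _ "t - s"]) auto
      qed
    qed
    then show ?thesis
      by (simp add: w_def S.T_0 T_0 embed_in_dual)
  next
    case False
    then show ?thesis
      using dual_outside[OF S.T_in[OF t embed_in_dual]] dual_outside[OF embed_in_dual] by simp
  qed
qed

text \<open>At a fixed test vector the defect \<open>D\<close> is a bounded real-linear function of
  \<open>x\<close> that vanishes on the domain of \<open>A\<close>; the averages of \<open>x\<close>
  carry this to all of H.\<close>

lemma S_embed:
  assumes t: "t \<ge> 0"
  shows "S t (embed A x) = embed A (T t x)"
proof
  fix \<phi>
  show "S t (embed A x) \<phi> = embed A (T t x) \<phi>"
  proof (cases "\<phi> \<in> dom_adj A")
    case \<phi>: True
    define D where "D x = S t (embed A x) \<phi> - embed A (T t x) \<phi>" for x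
    obtain K where K: "K \<ge> 0" "\<And>f. f \<in> dual_dom A \<Longrightarrow> dual_norm A (S t f) \<le> K * dual_norm A f"
      using S.T_locally_bounded[of t] t by blast
    obtain K' where K': "\<And>x. norm (T t x) \<le> K' * norm x"
      using T_locally_bounded[of t] t by auto
    have "bounded_linear D"
    proof (rule bounded_linear_intro)
      show "D (x + y) = D x + D y" for x y
        using t by (simp add: D_def embed_add S.T_add embed_in_dual T_add)
      show "D (c *\<^sub>R x) = c *\<^sub>R D x" for c x
        using t by (simp add: D_def embed_scaleR S.T_scaleR embed_in_dual T_scaleR
            scaleR_right_diff_distrib) (simp add: scaleR_fun_def)
      show "norm (D x) \<le> norm x * ((K + K') * graph_norm A \<phi>)" for x
      proof -
        have "cmod (S t (embed A x) \<phi>) \<le> dual_norm A (S t (embed A x)) * graph_norm A \<phi>"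
          using dual_bound[OF S.T_in[OF t embed_in_dual] \<phi>] .
        also have "\<dots> \<le> (K * norm x) * graph_norm A \<phi>"
          using order_trans[OF K(2)[OF embed_in_dual] mult_left_mono[OF dual_norm_embed K(1)]]
          by (intro mult_right_mono graph_norm_nonneg)
        finally have 1: "cmod (S t (embed A x) \<phi>) \<le> (K * norm x) * graph_norm A \<phi>" .
        have "cmod (embed A (T t x) \<phi>) \<le> dual_norm A (embed A (T t x)) * graph_norm A \<phi>"
          using dual_bound[OF embed_in_dual \<phi>] .
        also have "\<dots> \<le> (K' * norm x) * graph_norm A \<phi>"
          using order_trans[OF dual_norm_embed K'] by (intro mult_right_mono graph_norm_nonneg)
        finally show ?thesis
          using 1 norm_triangle_ineq4[of "S t (embed A x) \<phi>" "embed A (T t x) \<phi>"]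
          by (simp add: D_def algebra_simps)
      qed
    qed
    then have "((\<lambda>r. D ((1 / r) *\<^sub>R R r x)) \<longlongrightarrow> D x) (at_right 0)"
      by (rule bounded_linear.tendsto[OF _ R_average])
    moreover have "\<forall>\<^sub>F r in at_right 0. D ((1 / r) *\<^sub>R R r x) = 0"
      unfolding eventually_at_filter
    proof (intro always_eventually allI impI)
      fix r :: real assume "r \<in> {0<..}"
      then have "D (R r x) = 0"
        using S_embed_domain[OF t R_in_domain] by (simp add: D_def)
      then show "D ((1 / r) *\<^sub>R R r x) = 0"
        using \<open>bounded_linear D\<close> by (simp add: linear_cmul bounded_linear.linear)
    qed
    ultimately have "((\<lambda>r::real. 0) \<longlongrightarrow> D x) (at_right 0)"
      by (rule Lim_transform_eventually)
    then have "D x = 0"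
      by (rule tendsto_unique[OF trivial_limit_at_right_real _ tendsto_const])
    then show ?thesis by (simp add: D_def)
  next
    case False
    then show ?thesis
      using dual_outside[OF S.T_in[OF t embed_in_dual]] dual_outside[OF embed_in_dual] by simp
  qed
qed

text \<open>The second component is the image of an embedded vector under the generator, whose graph
  \<open>S t\<close> preserves. Injectivity of \<open>embed A\<close> identifies the vector that
  represents the image at time \<open>t\<close>.\<close>

lemma S_ext_pair:
  assumes t: "t \<ge> 0"
  shows "S t (ext_pair p) = ext_pair (T t (fst p), T t (snd p))"
proof -
  have split: "ext_pair q = embed A (fst q) + ext_pair (0, snd q)" for q
    using ext_pair_add[of "(fst q, 0)" "(0, snd q)"] by (simp add: embed_ext_pair)
  have "(embed A (snd p), ext_pair (0, snd p)) \<in> extended_op A"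
    unfolding extended_op_iff by blast
  from S.generator_invariant[OF this[folded extended_op_eq] t]
  have "(embed A (T t (snd p)), S t (ext_pair (0, snd p))) \<in> extended_op A"
    by (simp add: S_embed[OF t] extended_op_eq)
  then have "S t (ext_pair (0, snd p)) = ext_pair (0, T t (snd p))"
    unfolding extended_op_iff using embed_inject by blast
  then show ?thesis
    using split[of p] split[of "(T t (fst p), T t (snd p))"] t
    by (simp add: S.T_add embed_in_dual ext_pair_in_dual S_embed)
qed

text \<open>The bridge to the estimate, read off from the pair representation: \<open>S t\<close>
  pulls test vectors back along the adjoint of \<open>T t\<close>.\<close>

lemma S_dual:
  assumes t: "t \<ge> 0" and f: "f \<in> dual_dom A" and \<phi>: "\<phi> \<in> dom_adj A"
  shows "S t f \<phi> = f (cadjoint (T t) \<phi>)"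
proof -
  obtain p where p: "f = ext_pair p" using ext_pair_onto[OF f] by blast
  obtain K where K: "bounded_op K (T t)" using T_bounded_op[of t] t by blast
  have comm: "T t (T h x) = T h (T t x)" if "h \<ge> 0" for h x
    using T_plus[OF t that, of x] T_plus[OF that t, of x] by (simp add: add.commute)
  show ?thesis
    unfolding p S_ext_pair[OF t] using \<phi> adj_commute[OF K comm \<phi>]
    by (simp add: ext_pair_def cinner_cadjoint[OF K])
qed

end

section \<open>Evaluating Bochner integrals at test vectors\<close>

lemma (in banach_image) X_sum: "(\<And>i. i \<in> I \<Longrightarrow> g i \<in> X) \<Longrightarrow> sum g I \<in> X"
  using X X_add by (induction I rule: infinite_finite_induct) (auto simp: csubspace_def)

context hilbert_C0_semigroup
begin

text \<open>The integrand need not be measurable as a scalar function, hence the measurable majorant.\<close>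
lemma has_bochner_integral_in_eval_le:
  assumes int: "has_bochner_integral_in (dual_dom A) (dual_norm A) M f I"
    and \<phi>: "\<phi> \<in> dom_adj A" and b: "b \<in> borel_measurable M"
    and le: "AE x in M. ennreal (cmod (f x \<phi>)) \<le> b x"
  shows "ennreal (cmod (I \<phi>)) \<le> (\<integral>\<^sup>+x. b x \<partial>M)"
proof -
  have f: "\<And>x. x \<in> space M \<Longrightarrow> f x \<in> dual_dom A" and I: "I \<in> dual_dom A"
    using int by (auto simp: has_bochner_integral_in_def)
  obtain s where s: "\<And>i::nat. Bochner_Integration.simple_bochner_integrable M (s i)"
      "\<And>i x. x \<in> space M \<Longrightarrow> s i x \<in> dual_dom A"
    and e0: "(\<lambda>i. \<integral>\<^sup>+x. ennreal (dual_norm A (f x - s i x)) \<partial>M) \<longlonglongrightarrow> 0"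
    and n0: "(\<lambda>i. dual_norm A (Bochner_Integration.simple_bochner_integral M (s i) - I)) \<longlonglongrightarrow> 0"
    using int unfolding has_bochner_integral_in_def by blast
  define J where "J i = Bochner_Integration.simple_bochner_integral M (s i)" for i
  define e where "e i = (\<integral>\<^sup>+x. ennreal (dual_norm A (f x - s i x)) \<partial>M)" for i
  define n where "n i = dual_norm A (J i - I)" for i
  \<comment> \<open>Adding 1 keeps \<open>c\<close> positive, so that division by it is
    possible.\<close>
  define c where "c = graph_norm A \<phi> + 1"
  have c: "c > 0" "graph_norm A \<phi> \<le> c" using graph_norm_nonneg[of \<phi>] by (auto simp: c_def)
  have J: "J i \<in> dual_dom A" for i
    unfolding J_def simple_bochner_integral_def
    by (intro dual.X_sum dual.X_scaleR) (use s(2) in auto)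
  have bound: "ennreal (cmod (I \<phi>)) \<le> (\<integral>\<^sup>+x. b x \<partial>M) + ennreal c * e i + ennreal (c * n i)" for i
  proof -
    define h where "h x = s i x \<phi>" for x
    have h: "Bochner_Integration.simple_bochner_integrable M h"
      unfolding h_def by (rule simple_bochner_integrable_compose2[of "\<lambda>x y. x \<phi>", OF _ s(1) s(1)]) simp
    have nh: "Bochner_Integration.simple_bochner_integrable M (\<lambda>x. cmod (h x))"
      by (rule simple_bochner_integrable_compose2[of "\<lambda>x y. norm x", OF _ h h]) simp
    then have meas[measurable]: "(\<lambda>x. cmod (h x)) \<in> borel_measurable M"
      by (meson borel_measurable_simple_function simple_bochner_integrable.cases)
    note b[measurable]
    have lin: "linear (\<lambda>g::'h \<Rightarrow> complex. g \<phi>)"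
      by (rule linearI) (simp_all add: scaleR_fun_def)
    have "J i \<phi> = Bochner_Integration.simple_bochner_integral M h"
      unfolding J_def h_def by (rule simple_bochner_integral_linear[OF lin s(1), symmetric])
    then have "cmod (J i \<phi>) \<le> Bochner_Integration.simple_bochner_integral M (\<lambda>x. cmod (h x))"
      using simple_bochner_integral_norm_bound[OF h] by simp
    then have "ennreal (cmod (J i \<phi>)) \<le> (\<integral>\<^sup>+x. cmod (h x) \<partial>M)"
      using simple_bochner_integral_eq_nn_integral[OF nh] by (metis ennreal_leI norm_ge_zero)
    \<comment> \<open>Subtraction in \<open>ennreal\<close> is truncated at 0: the excess of the
      simple function over \<open>b\<close> is measurable and is controlled by the approximation
      error.\<close>
    also have "\<dots> \<le> (\<integral>\<^sup>+x. b x + (ennreal (cmod (h x)) - b x) \<partial>M)"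
      by (intro nn_integral_mono) (metis add.commute diff_add_cancel_ennreal ennreal_minus_mono ennreal_ineq_diff_add le_cases order_refl add_increasing2 zero_le)
    also have "\<dots> = (\<integral>\<^sup>+x. b x \<partial>M) + (\<integral>\<^sup>+x. ennreal (cmod (h x)) - b x \<partial>M)"
      by (rule nn_integral_add) measurable
    also have "(\<integral>\<^sup>+x. ennreal (cmod (h x)) - b x \<partial>M) \<le> ennreal c * e i"
    proof -
      \<comment> \<open>The factor goes into the measurable integrand on the left; the integrand of
        \<open>e i\<close> need not be measurable, so pulling \<open>c\<close> out of it would not
        be justified.\<close>
      have "ennreal (1 / c) * (\<integral>\<^sup>+x. ennreal (cmod (h x)) - b x \<partial>M)
          = (\<integral>\<^sup>+x. ennreal (1 / c) * (ennreal (cmod (h x)) - b x) \<partial>M)"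
        by (rule nn_integral_cmult[symmetric]) measurable
      also have "\<dots> \<le> e i"
        unfolding e_def
      proof (rule nn_integral_mono_AE)
        show "AE x in M. ennreal (1 / c) * (ennreal (cmod (h x)) - b x) \<le> ennreal (dual_norm A (f x - s i x))"
          using le AE_space
        proof eventually_elim
          case (elim x)
          have d: "f x - s i x \<in> dual_dom A" using f s(2) elim(2) by (intro dual.X_diff)
          have "cmod (h x) \<le> cmod (f x \<phi>) + cmod ((f x - s i x) \<phi>)"
            using norm_triangle_ineq4[of "f x \<phi>" "f x \<phi> - h x"] by (simp add: h_def)
          also have "cmod ((f x - s i x) \<phi>) \<le> c * dual_norm A (f x - s i x)"
            using dual_bound[OF d \<phi>] mult_left_mono[OF c(2) dual_norm_nonneg[OF d]] by (simp add: mult.commute)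
          finally have "ennreal (cmod (h x)) \<le> ennreal (cmod (f x \<phi>)) + ennreal (c * dual_norm A (f x - s i x))"
            using c(1) dual_norm_nonneg[OF d] by (simp flip: ennreal_plus add: ennreal_leI)
          also have "\<dots> \<le> b x + ennreal (c * dual_norm A (f x - s i x))"
            by (rule add_right_mono[OF elim(1)])
          finally have "ennreal (cmod (h x)) - b x \<le> ennreal (c * dual_norm A (f x - s i x))"
            by (simp add: ennreal_minus_le_iff ennreal_diff_le_mono_left)
          from mult_left_mono[OF this, of "ennreal (1 / c)"]
          show ?case using c(1) dual_norm_nonneg[OF d] by (simp flip: ennreal_mult)
        qed
      qed
      finally have "ennreal c * (ennreal (1 / c) * (\<integral>\<^sup>+x. ennreal (cmod (h x)) - b x \<partial>M)) \<le> ennreal c * e i"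
        by (rule mult_left_mono) simp
      then show ?thesis using c(1) by (simp add: mult.assoc[symmetric] ennreal_mult[symmetric])
    qed
    finally have 1: "ennreal (cmod (J i \<phi>)) \<le> (\<integral>\<^sup>+x. b x \<partial>M) + ennreal c * e i"
      by (simp add: add_left_mono)
    have d: "J i - I \<in> dual_dom A" by (rule dual.X_diff[OF J I])
    have "cmod (I \<phi>) \<le> cmod (J i \<phi>) + cmod ((J i - I) \<phi>)"
      using norm_triangle_ineq4[of "J i \<phi>" "J i \<phi> - I \<phi>"] by simp
    also have "cmod ((J i - I) \<phi>) \<le> c * n i"
      using dual_bound[OF d \<phi>] mult_left_mono[OF c(2) dual_norm_nonneg[OF d]]
      by (simp add: mult.commute n_def)
    finally have "ennreal (cmod (I \<phi>)) \<le> ennreal (cmod (J i \<phi>)) + ennreal (c * n i)"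
      using c(1) dual_norm_nonneg[OF d] by (simp flip: ennreal_plus add: ennreal_leI n_def)
    then show ?thesis using add_right_mono[OF 1] order_trans by blast
  qed
  have "(\<lambda>i. (\<integral>\<^sup>+x. b x \<partial>M) + ennreal c * e i + ennreal (c * n i))
      \<longlonglongrightarrow> (\<integral>\<^sup>+x. b x \<partial>M) + ennreal c * 0 + ennreal (c * 0)"
    by (intro tendsto_add tendsto_const ennreal_tendsto_cmult tendsto_ennrealI tendsto_mult_left)
      (use e0 n0 in \<open>simp_all add: e_def[abs_def] n_def[abs_def] J_def\<close>)
  then have "ennreal (cmod (I \<phi>)) \<le> (\<integral>\<^sup>+x. b x \<partial>M) + ennreal c * 0 + ennreal (c * 0)"
    by (rule LIMSEQ_le_const) (use bound in blast)
  then show ?thesis by simp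
qed

end

section \<open>Measurable norms, exponential weights and late times\<close>

lemma strongly_measurable_norm:
  assumes "strongly_measurable M u"
  shows "\<exists>V\<in>borel_measurable M. AE x in M. V x = ennreal (norm (u x))"
proof -
  obtain s where s: "\<And>i::nat. simple_function M (s i)" "AE x in M. (\<lambda>i. s i x) \<longlonglongrightarrow> u x"
    using assms by (auto simp: strongly_measurable_def)
  have [measurable]: "(\<lambda>x. ennreal (norm (s i x))) \<in> borel_measurable M" for i
    by (rule borel_measurable_simple_function)
      (rule simple_function_compose1[OF s(1), of "\<lambda>y. ennreal (norm y)"])
  \<comment> \<open>The limit inferior is measurable and equals the norm wherever the simple
    functions converge; it replaces the norm under later integrals.\<close>
  have "AE x in M. liminf (\<lambda>i. ennreal (norm (s i x))) = ennreal (norm (u x))"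
    using s(2)
  proof eventually_elim
    case (elim x)
    then show ?case
      by (intro lim_imp_Liminf tendsto_ennrealI tendsto_norm) simp
  qed
  moreover have "(\<lambda>x. liminf (\<lambda>i. ennreal (norm (s i x)))) \<in> borel_measurable M" by measurable
  ultimately show ?thesis by (rule bexI)
qed

text \<open>Enlarging the interval to the half-line removes the dependence on \<open>t\<close>; the
  bound is used with \<open>k = 2 * \<gamma>\<close>.\<close>

lemma nn_integral_exp_le:
  fixes k :: real
  assumes "k > 0"
  shows "(\<integral>\<^sup>+x. ennreal (exp (- k * x)) \<partial>lebesgue_on {0<..<t}) \<le> ennreal (1 / k)"
proof -
  have "(\<integral>\<^sup>+x. ennreal (exp (- k * x)) \<partial>lebesgue_on {0<..<t})
      = (\<integral>\<^sup>+x. ennreal (exp (- k * x)) * indicator {0<..<t} x \<partial>lborel)"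
    by (subst nn_integral_restrict_space) (auto simp: nn_integral_completion)
  also have "\<dots> \<le> (\<integral>\<^sup>+x. ennreal (exp (- k * x)) * indicator {0..} x \<partial>lborel)"
    by (intro nn_integral_mono) (auto simp: indicator_def)
  also have "\<dots> = 0 - (- exp (- k * 0) / k)"
  proof (rule nn_integral_FTC_atLeast)
    show "((\<lambda>x. - exp (- k * x) / k) has_real_derivative exp (- k * x)) (at x)" for x
      using assms by (auto intro!: derivative_eq_intros)
    have "filterlim (\<lambda>x. k * x) at_top at_top"
      using assms by (intro filterlim_tendsto_pos_mult_at_top[OF tendsto_const] filterlim_ident)
    then have "((\<lambda>x. exp (- (k * x))) \<longlongrightarrow> 0) at_top"
      by (intro filterlim_compose[OF exp_at_bot] filterlim_compose[OF filterlim_uminus_at_bot_at_top])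
    then have "((\<lambda>x. - exp (- (k * x)) / k) \<longlongrightarrow> - 0 / k) at_top"
      using assms by (intro tendsto_intros) auto
    then show "((\<lambda>x. - exp (- k * x) / k) \<longlongrightarrow> 0) at_top" by simp
  qed auto
  finally show ?thesis by simp
qed

text \<open>If \<open>P\<close> failed at all points beyond \<open>a\<close>, a unit interval would
  be null.\<close>

lemma AE_lebesgue_obtain_greater:
  fixes a :: real
  assumes "AE t in lebesgue. P t"
  obtains t where "t > a" "P t"
proof (rule ccontr)
  assume "\<not> thesis"
  then have "\<not> P t" if "t > a" for t using that \<open>\<And>t. a < t \<Longrightarrow> P t \<Longrightarrow> thesis\<close> by blast
  then have "AE t in lebesgue. \<not> t \<in> {a<..<a + 1}" using assms by (auto elim!: eventually_mono)
  then have "{a<..<a + 1} \<in> null_sets lebesgue" by (simp add: AE_iff_null_sets)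
  then show False by (simp add: null_sets_def)
qed

section \<open>Projections along closed complements\<close>

lemma csubspace_subspace: "csubspace X \<Longrightarrow> subspace X"
  unfolding csubspace_def subspace_def by (metis scaleC_of_real)

text \<open>Closedness enters through countable subadditivity: for a series with summable component
  norms the components sum within \<open>E\<close> and within \<open>F\<close>, so uniqueness of the
  decomposition identifies these sums with the components of the limit. Zabreiko's lemma then bounds
  \<open>P\<close>.\<close>

lemma complementary_projection:
  fixes E F :: "'h::complex_hilbert set"
  assumes E: "csubspace E" "closed E" and F: "csubspace F" "closed F" and EF: "E \<inter> F = {0}"
    and decomp: "\<And>x. \<exists>e\<in>E. \<exists>f\<in>F. x = e + f"
  shows "\<exists>P K. bounded_op K P \<and> (\<forall>e\<in>E. \<forall>f\<in>F. P (e + f) = e)"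
proof -
  note sub = csubspace_subspace[OF E(1)] csubspace_subspace[OF F(1)]
  have uniq: "e = e'" if "e \<in> E" "e' \<in> E" "f \<in> F" "f' \<in> F" "e + f = e' + f'" for e e' f f'
  proof -
    have "e - e' = f' - f" using that(5) by (simp add: algebra_simps)
    then have "e - e' \<in> E \<inter> F" using that sub by (metis IntI subspace_diff)
    then show ?thesis using EF by simp
  qed
  define P where "P x = (THE e. e \<in> E \<and> x - e \<in> F)" for x
  have P_eq: "P (e + f) = e" if "e \<in> E" "f \<in> F" for e f
    unfolding P_def
  proof (rule the_equality)
    show "e' = e" if "e' \<in> E \<and> e + f - e' \<in> F" for e'
      using uniq[of e' e "e + f - e'" f] that \<open>e \<in> E\<close> \<open>f \<in> F\<close> by simp
  qed (use that in simp)
  have P_in: "P x \<in> E" "x - P x \<in> F" for x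
    using decomp[of x] P_eq by auto
  have P_add: "P (x + y) = P x + P y" for x y
    using P_eq[of "P x + P y" "(x - P x) + (y - P y)"] P_in sub by (simp add: subspace_add)
  have P_scaleC: "P (c *\<^sub>C x) = c *\<^sub>C P x" for c x
    using P_eq[of "c *\<^sub>C P x" "c *\<^sub>C (x - P x)"] P_in E(1) F(1)
    by (simp add: csubspace_def scaleC_add_right[symmetric])
  have P_scaleR: "P (c *\<^sub>R x) = c *\<^sub>R P x" for c x by (metis P_scaleC scaleC_of_real)
  have "\<exists>C\<ge>0. \<forall>x. norm (P x) + norm (x - P x) \<le> C * norm x"
  proof (rule countably_subadditive_seminorm_bounded)
    show "norm (P (x + y)) + norm (x + y - P (x + y))
        \<le> (norm (P x) + norm (x - P x)) + (norm (P y) + norm (y - P y))" for x y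
      using norm_triangle_ineq[of "P x" "P y"] norm_triangle_ineq[of "x - P x" "y - P y"]
      by (simp add: P_add algebra_simps)
    show "norm (P (c *\<^sub>R x)) + norm (c *\<^sub>R x - P (c *\<^sub>R x)) = \<bar>c\<bar> * (norm (P x) + norm (x - P x))" for c x
      by (simp add: P_scaleR scaleR_right_diff_distrib[symmetric] distrib_left)
    fix s :: "nat \<Rightarrow> 'h" and x
    assume sm: "summable (\<lambda>n. norm (P (s n)) + norm (s n - P (s n)))" and s: "s sums x"
    have sm1: "summable (\<lambda>n. norm (P (s n)))" and sm2: "summable (\<lambda>n. norm (s n - P (s n)))"
      by (rule summable_comparison_test'[OF sm]; simp)+
    define e where "e = (\<Sum>n. P (s n))"
    have e: "(\<lambda>n. P (s n)) sums e"
      unfolding e_def by (rule summable_sums[OF summable_norm_cancel[OF sm1]])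
    have f: "(\<lambda>n. s n - P (s n)) sums (x - e)" by (rule sums_diff[OF s e])
    have "e \<in> E"
      by (rule closed_sequentially[OF E(2) _ e[unfolded sums_def]]) (intro subspace_sum sub P_in)
    moreover have "x - e \<in> F"
      by (rule closed_sequentially[OF F(2) _ f[unfolded sums_def]]) (intro subspace_sum sub P_in)
    ultimately have "P x = e" using P_eq[of e "x - e"] by simp
    moreover have "norm e \<le> (\<Sum>n. norm (P (s n)))" unfolding e_def by (rule summable_norm[OF sm1])
    moreover have "norm (x - e) \<le> (\<Sum>n. norm (s n - P (s n)))"
      using summable_norm[OF sm2] sums_unique[OF f] by simp
    ultimately show "norm (P x) + norm (x - P x) \<le> (\<Sum>n. norm (P (s n)) + norm (s n - P (s n)))"
      by (simp add: suminf_add[OF sm1 sm2, symmetric])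
  qed
  then obtain C where C: "\<And>x. norm (P x) + norm (x - P x) \<le> C * norm x" by blast
  have "norm (P x) \<le> C * norm x" for x using C[of x] norm_ge_zero[of "x - P x"] by linarith
  then have "bounded_op C P" by (simp add: bounded_op_def P_add P_scaleC)
  then show ?thesis using P_eq by blast
qed

section \<open>The cost of steering to rest\<close>

text \<open>\<open>Q s\<close> stands for e^{-As} P. The bound contains no \<open>t\<close>:
  Cauchy-Schwarz separates the energy from the squared weight
  \<open>C * exp (- \<gamma> * s)\<close>, whose integral is bounded by that over the
  half-line.\<close>

lemma (in extended_C0_semigroup) cost_of_rest:
  fixes B :: "'u::complex_hilbert \<Rightarrow> 'h \<Rightarrow> complex" and Q :: "real \<Rightarrow> 'h \<Rightarrow> 'h"
  assumes Q: "\<And>s. s \<ge> 0 \<Longrightarrow> bounded_op (D * exp (- \<gamma> * s)) (Q s)"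
    and comm: "\<And>s h x. s \<ge> 0 \<Longrightarrow> h \<ge> 0 \<Longrightarrow> Q s (T h x) = T h (Q s x)"
    and shift: "\<And>s t x. 0 \<le> s \<Longrightarrow> s \<le> t \<Longrightarrow> Q t (T (t - s) x) = Q s x"
    and D: "D \<ge> 0" and \<gamma>: "\<gamma> > 0"
    and B: "\<And>x. B x \<in> dual_dom A" "\<And>x. dual_norm A (B x) \<le> K * norm x" and K: "K \<ge> 0"
    and t: "t > 0" and u: "strongly_measurable (lebesgue_on {0<..<t}) u"
    and cost: "energy {0<..<t} u \<le> ennreal (\<epsilon>\<^sup>2)"
    and int: "input_integral A S B u t v" and rest: "embed A (T t y0) + v = 0"
    and \<phi>: "\<phi> \<in> dom_adj A"
  shows "(cmod (cinner (Q 0 y0) \<phi>))\<^sup>2 \<le> (K * D * graph_norm A \<phi>)\<^sup>2 * (1 / (2 * \<gamma>)) * \<epsilon>\<^sup>2"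
proof -
  let ?M = "lebesgue_on {0<..<t}"
  define C where "C = K * D * graph_norm A \<phi>"
  have C: "C \<ge> 0" using K D graph_norm_nonneg[of \<phi>] by (simp add: C_def)
  define \<phi>t where "\<phi>t = cadjoint (Q t) \<phi>"
  have t0: "t \<ge> 0" using t by simp
  have \<phi>t: "\<phi>t \<in> dom_adj A"
    unfolding \<phi>t_def by (rule adj_commute(1)[OF Q[OF t0] comm[OF t0] \<phi>])
  have "v \<phi>t = - cinner (T t y0) \<phi>t"
    using fun_cong[OF rest, of \<phi>t] \<phi>t by (simp add: embed_def add_eq_0_iff)
  also have "cinner (T t y0) \<phi>t = cinner (Q 0 y0) \<phi>"
    unfolding \<phi>t_def cinner_cadjoint[OF Q[OF t0], symmetric] using shift[of 0 t y0] t by simp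
  finally have v: "cmod (v \<phi>t) = cmod (cinner (Q 0 y0) \<phi>)" by simp
  obtain V where V: "V \<in> borel_measurable ?M" "AE s in ?M. V s = ennreal (norm (u s))"
    using strongly_measurable_norm[OF u] by blast
  note V(1)[measurable]
  have [measurable]: "(\<lambda>s. exp (- \<gamma> * s)) \<in> borel_measurable ?M"
    by (intro measurable_restrict_space1 measurable_completion) measurable
  define b where "b s = ennreal (C * exp (- \<gamma> * s)) * V s" for s
  have b: "b \<in> borel_measurable ?M" unfolding b_def by measurable
  have "ennreal (cmod (v \<phi>t)) \<le> (\<integral>\<^sup>+s. b s \<partial>?M)"
  proof (rule has_bochner_integral_in_eval_le[OF int[unfolded input_integral_def] \<phi>t b])
    show "AE s in ?M. ennreal (cmod (S (t - s) (B (u s)) \<phi>t)) \<le> b s"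
      using V(2) AE_space
    proof eventually_elim
      case (elim s)
      then have s: "s \<ge> 0" "t - s \<ge> 0" by auto
      obtain K' where K': "bounded_op K' (T (t - s))" using T_bounded_op[of "t - s"] s by blast
      \<comment> \<open>Adjoint form of \<open>shift\<close>: pulling \<open>\<phi>t\<close> back by
        \<open>t - s\<close> leaves a vector that no longer depends on \<open>t\<close>.\<close>
      have "cadjoint (T (t - s)) \<phi>t - cadjoint (Q s) \<phi> = 0"
      proof (rule eq_zero_if_cinner_zero)
        fix x
        show "cinner x (cadjoint (T (t - s)) \<phi>t - cadjoint (Q s) \<phi>) = 0"
          unfolding cinner_diff_right \<phi>t_def cinner_cadjoint[OF K', symmetric]
            cinner_cadjoint[OF Q[OF t0], symmetric] cinner_cadjoint[OF Q[OF s(1)], symmetric]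
          using shift[of s t x] s by simp
      qed
      then have "S (t - s) (B (u s)) \<phi>t = B (u s) (cadjoint (Q s) \<phi>)"
        using S_dual[OF s(2) B(1) \<phi>t] by simp
      also have "cmod \<dots> \<le> dual_norm A (B (u s)) * graph_norm A (cadjoint (Q s) \<phi>)"
        by (rule dual_bound[OF B(1) adj_commute(1)[OF Q[OF s(1)] comm[OF s(1)] \<phi>]])
      also have "\<dots> \<le> (K * norm (u s)) * ((D * exp (- \<gamma> * s)) * graph_norm A \<phi>)"
        using K by (intro mult_mono B(2) graph_norm_cadjoint_le[OF Q[OF s(1)] comm[OF s(1)] \<phi>])
          (simp_all add: graph_norm_nonneg)
      also have "\<dots> = C * exp (- \<gamma> * s) * norm (u s)" by (simp add: C_def mult_ac)
      finally show ?case using C elim(1) by (simp add: b_def ennreal_leI flip: ennreal_mult)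
    qed
  qed
  then have "(ennreal (cmod (v \<phi>t)))\<^sup>2 \<le> (\<integral>\<^sup>+s. b s \<partial>?M)\<^sup>2"
    by (intro power_mono) auto
  also have "\<dots> \<le> (\<integral>\<^sup>+s. (ennreal (C * exp (- \<gamma> * s)))\<^sup>2 \<partial>?M) * (\<integral>\<^sup>+s. (V s)\<^sup>2 \<partial>?M)"
    unfolding b_def by (rule Cauchy_Schwarz_nn_integral) measurable
  also have "\<dots> \<le> ennreal (C\<^sup>2 * (1 / (2 * \<gamma>))) * ennreal (\<epsilon>\<^sup>2)"
  proof (rule mult_mono)
    have "(\<integral>\<^sup>+s. (ennreal (C * exp (- \<gamma> * s)))\<^sup>2 \<partial>?M) = (\<integral>\<^sup>+s. ennreal (C\<^sup>2) * ennreal (exp (- (2 * \<gamma>) * s)) \<partial>?M)"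
      using C by (intro nn_integral_cong)
        (simp add: ennreal_power power_mult_distrib exp_double[symmetric] ennreal_mult[symmetric] mult_ac)
    also have "\<dots> = ennreal (C\<^sup>2) * (\<integral>\<^sup>+s. ennreal (exp (- (2 * \<gamma>) * s)) \<partial>?M)"
    proof (rule nn_integral_cmult)
      show "(\<lambda>s. ennreal (exp (- (2 * \<gamma>) * s))) \<in> borel_measurable ?M"
        by (intro measurable_restrict_space1 measurable_completion) measurable
    qed
    also have "\<dots> \<le> ennreal (C\<^sup>2) * ennreal (1 / (2 * \<gamma>))"
      using \<gamma> by (intro mult_left_mono nn_integral_exp_le) auto
    also have "\<dots> = ennreal (C\<^sup>2 * (1 / (2 * \<gamma>)))"
      using \<gamma> by (intro ennreal_mult[symmetric]) simp_all
    finally show "(\<integral>\<^sup>+s. (ennreal (C * exp (- \<gamma> * s)))\<^sup>2 \<partial>?M) \<le> ennreal (C\<^sup>2 * (1 / (2 * \<gamma>)))" .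
    have "(\<integral>\<^sup>+s. (V s)\<^sup>2 \<partial>?M) = energy {0<..<t} u"
      unfolding energy_def using V(2)
      by (intro nn_integral_cong_AE) (auto elim!: eventually_mono simp: ennreal_power)
    then show "(\<integral>\<^sup>+s. (V s)\<^sup>2 \<partial>?M) \<le> ennreal (\<epsilon>\<^sup>2)" using cost by simp
  qed auto
  also have "\<dots> = ennreal (C\<^sup>2 * (1 / (2 * \<gamma>)) * \<epsilon>\<^sup>2)"
    using \<gamma> by (intro ennreal_mult[symmetric]) simp_all
  finally have "ennreal ((cmod (v \<phi>t))\<^sup>2) \<le> ennreal (C\<^sup>2 * (1 / (2 * \<gamma>)) * \<epsilon>\<^sup>2)"
    by (simp only: ennreal_power norm_ge_zero)
  then show ?thesis
    using \<gamma> by (simp add: v C_def)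
qed

lemma energy_mono_set:
  assumes "X \<in> sets lebesgue" "Y \<in> sets lebesgue" "X \<subseteq> Y"
  shows "energy X u \<le> energy Y u"
proof -
  have "energy Z u = (\<integral>\<^sup>+s. ennreal ((norm (u s))\<^sup>2) * indicator Z s \<partial>lebesgue)" if "Z \<in> sets lebesgue" for Z
    unfolding energy_def using that by (subst nn_integral_restrict_space) auto
  then show ?thesis
    using assms by (auto intro!: nn_integral_mono split: split_indicator)
qed

text \<open>The solution formula and the vanishing of \<open>y\<close> both hold almost everywhere
  beyond \<tau>, so some single time satisfies both.\<close>

lemma steers_to_restE:
  assumes "steers_to_rest A T S B y0 u \<tau>"
  obtains t v where "t > 0" "strongly_measurable (lebesgue_on {0<..<t}) u"
    "input_integral A S B u t v" "embed A (T t y0) + v = 0"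
proof -
  obtain y where u: "u \<in> L2_loc"
    and sol: "AE t in lebesgue_on {0<..}. \<exists>v. input_integral A S B u t v \<and> embed A (y t) = embed A (T t y0) + v"
    and y: "0 \<le> \<tau>" "AE t in lebesgue_on {\<tau><..}. y t = 0"
    using assms by (auto simp: steers_to_rest_def is_solution_def supported_upto_def)
  have "AE t in lebesgue. t > 0 \<longrightarrow> (\<exists>v. input_integral A S B u t v \<and> embed A (y t) = embed A (T t y0) + v)"
    using sol by (subst (asm) AE_restrict_space_iff) auto
  moreover have "AE t in lebesgue. t > \<tau> \<longrightarrow> y t = 0"
    using y(2) by (subst (asm) AE_restrict_space_iff) auto
  ultimately have "AE t in lebesgue. t > \<tau> \<longrightarrow>
      (\<exists>v. input_integral A S B u t v \<and> embed A (T t y0) + v = 0)"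
  proof eventually_elim
    case (elim t)
    have "embed A 0 = 0" by (simp add: embed_def zero_fun_def cong: if_cong)
    then show ?case using elim y(1) by (metis order_le_less_trans)
  qed
  then obtain t where t: "t > \<tau>"
      "t > \<tau> \<longrightarrow> (\<exists>v. input_integral A S B u t v \<and> embed A (T t y0) + v = 0)"
    by (rule AE_lebesgue_obtain_greater)
  moreover have "strongly_measurable (lebesgue_on {0<..<t}) u"
    using u t(1) y(1) by (auto simp: L2_loc_def L2_on_def)
  ultimately show thesis using that y(1) by (meson order_le_less_trans)
qed

section \<open>The backward flow on the reducing subspace\<close>

theorem theorem1p5:
  fixes A :: "('h::complex_hilbert \<times> 'h) set"
    and T :: "real \<Rightarrow> 'h \<Rightarrow> 'h"
    and S :: "real \<Rightarrow> ('h \<Rightarrow> complex) \<Rightarrow> ('h \<Rightarrow> complex)"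
    and B :: "'u::complex_hilbert \<Rightarrow> ('h \<Rightarrow> complex)"
    and E :: "'h set"
    and G :: "real \<Rightarrow> 'h \<Rightarrow> 'h"
    and M \<gamma> :: real
  assumes "generates UNIV norm A T"
    and "generates (dual_dom A) (dual_norm A) (extended_op A) S"
    and "bounded_clinear_between UNIV norm (dual_dom A) (dual_norm A) B"
    and "\<And>\<tau>. \<tau> > 0 \<Longrightarrow> input_map_continuous A S B \<tau>"
    and "reducing_subspace T E" and "E \<noteq> {0}"
    and "C0_group E norm G"
    and "\<And>t x. t \<ge> 0 \<Longrightarrow> x \<in> E \<Longrightarrow> G t x = T t x"
    and "M \<ge> 1" and "\<gamma> > 0"
    and "\<And>t y. t \<ge> 0 \<Longrightarrow> y \<in> E \<Longrightarrow> norm (G (- t) y) \<le> M * exp (- \<gamma> * t) * norm y"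
  shows "\<not> NCVE A T S B"
proof
  assume NCVE: "NCVE A T S B"
  interpret extended_C0_semigroup A T S
    using assms(1,2) by unfold_locales
  note reducing = assms(5)[unfolded reducing_subspace_def]
  have E: "csubspace E" "closed E" using reducing by simp_all
  from reducing obtain F where F: "csubspace F" "closed F" and EF: "E \<inter> F = {0}"
    and decomp_all: "\<forall>x. \<exists>e\<in>E. \<exists>f\<in>F. x = e + f"
    and inv_all: "\<forall>t\<ge>0. T t ` E \<subseteq> E \<and> T t ` F \<subseteq> F"
    by (elim conjE exE) (rule that)
  note decomp = decomp_all[rule_format] and inv = inv_all[rule_format]
  obtain P D where P: "bounded_op D P" and P_eq: "\<And>e f. e \<in> E \<Longrightarrow> f \<in> F \<Longrightarrow> P (e + f) = e"
    using complementary_projection[OF E F EF decomp] by blast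
  have P_in: "P x \<in> E" for x using decomp[of x] P_eq by auto
  have "0 \<in> F" using F by (simp add: csubspace_def)
  then have P_E: "P e = e" if "e \<in> E" for e using P_eq[OF that, of 0] by simp
  have PT: "P (T t x) = T t (P x)" if "t \<ge> 0" for t x
  proof -
    obtain e f where ef: "e \<in> E" "f \<in> F" "x = e + f" using decomp by blast
    have "T t e \<in> E" "T t f \<in> F" using inv[OF that] ef by auto
    then show ?thesis using P_eq ef that by (simp add: T_add)
  qed
  have G_in: "G t x \<in> E" and G_scale: "G t (c *\<^sub>C x) = c *\<^sub>C G t x"
    and G_plus: "G (s + t) x = G s (G t x)" and G_0: "G 0 x = x" if "x \<in> E" for s t c x
    using assms(7) that by (auto simp: C0_group_def bounded_clinear_between_def)
  have G_add: "G t (x + y) = G t x + G t y" if "x \<in> E" "y \<in> E" for t x y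
    using assms(7) that by (auto simp: C0_group_def bounded_clinear_between_def)
  \<comment> \<open>The group acts on \<open>E\<close>, so the projection comes first; it commutes
    with the semigroup because both summands are invariant.\<close>
  define Q where "Q s x = G (- s) (P x)" for s x
  \<comment> \<open>\<open>\<bar>D\<bar>\<close> replaces \<open>D\<close>, whose sign
    \<open>bounded_op\<close> leaves open.\<close>
  have Q: "bounded_op (M * \<bar>D\<bar> * exp (- \<gamma> * s)) (Q s)" if s: "s \<ge> 0" for s
    unfolding bounded_op_def
  proof (intro conjI allI)
    fix x
    have "norm (Q s x) \<le> M * exp (- \<gamma> * s) * norm (P x)"
      unfolding Q_def by (rule assms(11)[OF s P_in])
    also have "norm (P x) \<le> \<bar>D\<bar> * norm x"
      using bounded_op_bound[OF P, of x] by (rule order_trans) (simp add: mult_right_mono)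
    finally show "norm (Q s x) \<le> M * \<bar>D\<bar> * exp (- \<gamma> * s) * norm x"
      using assms(9) by (simp add: mult_ac mult_left_mono)
  qed (use P in \<open>auto simp: Q_def bounded_op_def G_add P_in G_scale\<close>)
  \<comment> \<open>On \<open>E\<close> both factors belong to the commutative group
    \<open>G\<close>.\<close>
  have comm: "Q s (T h x) = T h (Q s x)" if "s \<ge> 0" "h \<ge> 0" for s h x
    using that P_in[of x] G_plus[of "P x" "- s" h] G_plus[of "P x" h "- s"]
    by (simp add: Q_def PT assms(8)[symmetric] G_in add.commute)
  have shift: "Q t (T (t - s) x) = Q s x" if "0 \<le> s" "s \<le> t" for s t x
    using that P_in[of x] G_plus[of "P x" "- t" "t - s"]
    by (simp add: Q_def PT assms(8)[symmetric])
  obtain K0 where B: "\<And>x. B x \<in> dual_dom A" and K0: "\<And>x. dual_norm A (B x) \<le> K0 * norm x"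
    using assms(3) by (auto simp: bounded_clinear_between_def)
  have K: "dual_norm A (B x) \<le> \<bar>K0\<bar> * norm x" for x
    using K0[of x] by (rule order_trans) (simp add: mult_right_mono)
  obtain y0 where y0: "y0 \<in> E" "y0 \<noteq> 0"
    using assms(6) E(1) by (auto simp: csubspace_def)
  have "cinner y0 \<phi> = 0" if \<phi>: "\<phi> \<in> dom_adj A" for \<phi>
  proof -
    define C where "C = (\<bar>K0\<bar> * (M * \<bar>D\<bar>) * graph_norm A \<phi>)\<^sup>2 * (1 / (2 * \<gamma>))"
    have C: "C \<ge> 0" using assms(10) by (simp add: C_def)
    have le: "(cmod (cinner y0 \<phi>))\<^sup>2 \<le> C * \<epsilon>\<^sup>2" if \<epsilon>: "\<epsilon> > 0" for \<epsilon>
    proof -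
      obtain \<tau> u where u: "steers_to_rest A T S B y0 u \<tau>" "energy {0<..} u \<le> ennreal (\<epsilon>\<^sup>2)"
        using NCVE \<epsilon> unfolding NCVE_def NCVE_element_def by blast
      obtain t v where t: "t > 0" "strongly_measurable (lebesgue_on {0<..<t}) u"
        "input_integral A S B u t v" "embed A (T t y0) + v = 0"
        using steers_to_restE[OF u(1)] by blast
      have "energy {0<..<t} u \<le> ennreal (\<epsilon>\<^sup>2)"
        by (rule order_trans[OF energy_mono_set u(2)]) auto
      from cost_of_rest[OF Q comm shift _ assms(10) B K _ t(1,2) this t(3,4) \<phi>]
      show ?thesis using assms(9) by (simp add: C_def Q_def P_E[OF y0(1)] G_0[OF y0(1)])
    qed
    have "(cmod (cinner y0 \<phi>))\<^sup>2 \<le> 0 + e" if e: "e > 0" for e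
    proof -
      \<comment> \<open>The tolerance is chosen so that \<open>C * \<epsilon>\<^sup>2\<close> is at
        most \<open>e\<close>; the denominator \<open>C + 1\<close> covers
        \<open>C = 0\<close>.\<close>
      have "(cmod (cinner y0 \<phi>))\<^sup>2 \<le> C * (sqrt (e / (C + 1)))\<^sup>2"
        using e C by (intro le) simp
      also have "\<dots> \<le> e" using e C by (simp add: field_simps)
      finally show ?thesis by simp
    qed
    then have "(cmod (cinner y0 \<phi>))\<^sup>2 \<le> 0" by (rule field_le_epsilon)
    then show ?thesis by simp
  qed
  then show False using dom_adj_separating y0(2) by blast
qed

end
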